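(* Let $(X_i)_{i\ge 1}$ be a sequence of i.i.d. real valued random variables with distribution function $F$, characteristic function $f(t)=E[e^{itX_1}]$ and variance $\sigma^2$. Suppose that Cramér's condition $\limsup_{|t|\to\infty}|f(t)|<1$ holds. Suppose furthermore that there exists an integer $m\ge 1$ such that $E[|X_1|^{m+2}]<\infty$, and let $\alpha\in\left(\frac{2}{m+2},1\right)$. If $k=k_n$ satisfies $k\sim n^{\alpha}$ as $n\to\infty$, then $$F_+\left(\frac{\sqrt{k}\,\sigma x}{n}\right)-F_-\left(\frac{\sqrt{k}\,\sigma x}{n}\right)=\frac{x e^{-x^2/2}}{\sqrt{2\pi}}\,\frac{k}{n}+o\left(\frac{k}{n}\right)$$ as $n\to\infty$, uniformly in $x\in\mathbb{R}$.
   Context: For $n\ge1$ let $Y_n=\frac1n\sum_{i=1}^n X_i$ be the sample mean of the first $n$ variables. For integers $1\le k<n$ set $\Delta_{n,+k}=Y_{n+k}-Y_n$ and $\Delta_{n,-k}=Y_n-Y_{n-k}$. $F_+$ and $F_-$ denote the distribution functions of $\Delta_{n,+k}$ and $\Delta_{n,-k}$ respectively (they depend on $n$ and $k$). Here $k=k_n$ is a sequence of positive integers, $k\sim n^\alpha$ means $k_n/n^\alpha\to1$, and "uniformly in $x$" means that the supremum over $x\in\mathbb{R}$ of the absolute value of the remainder is $o(k/n)$. *)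

theory Defs
  imports "HOL-Probability.Probability" "HOL-Library.Landau_Symbols"
begin

text \<open>
  The sequence of random variables is indexed from 1; \<open>X 0\<close> is never used.
\<close>

definition sample_mean :: "(nat \<Rightarrow> 'a \<Rightarrow> real) \<Rightarrow> nat \<Rightarrow> 'a \<Rightarrow> real" where
  "sample_mean X n \<omega> = (\<Sum>i=1..n. X i \<omega>) / real n"

definition Delta_plus :: "(nat \<Rightarrow> 'a \<Rightarrow> real) \<Rightarrow> nat \<Rightarrow> nat \<Rightarrow> 'a \<Rightarrow> real" where
  "Delta_plus X n k \<omega> = sample_mean X (n + k) \<omega> - sample_mean X n \<omega>"

text \<open>The subtraction \<open>n - k\<close> is on the naturals; the definition is meaningful for \<open>1 \<le> k < n\<close>.\<close>

definition Delta_minus :: "(nat \<Rightarrow> 'a \<Rightarrow> real) \<Rightarrow> nat \<Rightarrow> nat \<Rightarrow> 'a \<Rightarrow> real" where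
  "Delta_minus X n k \<omega> = sample_mean X n \<omega> - sample_mean X (n - k) \<omega>"

definition F_plus :: "'a measure \<Rightarrow> (nat \<Rightarrow> 'a \<Rightarrow> real) \<Rightarrow> nat \<Rightarrow> nat \<Rightarrow> real \<Rightarrow> real" where
  "F_plus M X n k = cdf (distr M borel (Delta_plus X n k))"

definition F_minus :: "'a measure \<Rightarrow> (nat \<Rightarrow> 'a \<Rightarrow> real) \<Rightarrow> nat \<Rightarrow> nat \<Rightarrow> real \<Rightarrow> real" where
  "F_minus M X n k = cdf (distr M borel (Delta_minus X n k))"

text \<open>
  Uniformity in \<open>x\<close> is measured by a supremum taken in \<open>real\<close>, which is only meaningful for
  sets bounded above. This holds for all \<open>n\<close> and \<open>k\<close>, including those with \<open>k \<ge> n\<close>.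
\<close>

lemma bdd_above_remainder:
  assumes M: "prob_space M" and X: "\<And>i. i \<ge> 1 \<Longrightarrow> X i \<in> borel_measurable M"
  shows "bdd_above (range (\<lambda>x.
    \<bar>F_plus M X n k (sqrt (real k) * \<sigma> * x / real n)
     - F_minus M X n k (sqrt (real k) * \<sigma> * x / real n)
     - x * exp (- x\<^sup>2 / 2) / sqrt (2 * pi) * (real k / real n)\<bar>))"
proof -
  have meas: "sample_mean X j \<in> borel_measurable M" for j
    unfolding sample_mean_def using X by (intro borel_measurable_divide borel_measurable_sum) auto
  have cdf01: "0 \<le> cdf (distr M borel f) y \<and> cdf (distr M borel f) y \<le> 1"
    if "f \<in> borel_measurable M" for f :: "'a \<Rightarrow> real" and y
  proof -
    interpret P: prob_space "distr M borel f"
      using prob_space.prob_space_distr[OF M that] .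
    show ?thesis by (simp add: cdf_def)
  qed
  have p: "0 \<le> F_plus M X n k y \<and> F_plus M X n k y \<le> 1"
   and m: "0 \<le> F_minus M X n k y \<and> F_minus M X n k y \<le> 1" for y
    unfolding F_plus_def F_minus_def Delta_plus_def Delta_minus_def
    by (intro cdf01 borel_measurable_diff meas)+
  have e: "\<bar>x * exp (- x\<^sup>2 / 2)\<bar> \<le> 1" for x :: real
  proof -
    have "\<bar>x\<bar> \<le> 1 + x\<^sup>2 / 2"
      using zero_le_power2[of "\<bar>x\<bar> - 1"] by (simp add: power2_diff)
    also have "\<dots> \<le> exp (x\<^sup>2 / 2)" by (rule exp_ge_add_one_self)
    finally show ?thesis by (simp add: abs_mult exp_minus divide_simps)
  qed
  show ?thesis
  proof (rule bdd_aboveI2)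
    fix x :: real
    let ?c = "real k / real n / sqrt (2 * pi)"
    have "\<bar>x * exp (- x\<^sup>2 / 2) / sqrt (2 * pi) * (real k / real n)\<bar>
        = \<bar>x * exp (- x\<^sup>2 / 2)\<bar> * ?c"
      by (simp add: abs_mult)
    also have "\<dots> \<le> 1 * ?c"
      by (rule mult_right_mono[OF e]) simp
    finally have "\<bar>x * exp (- x\<^sup>2 / 2) / sqrt (2 * pi) * (real k / real n)\<bar> \<le> ?c"
      by simp
    then show "\<bar>F_plus M X n k (sqrt (real k) * \<sigma> * x / real n)
        - F_minus M X n k (sqrt (real k) * \<sigma> * x / real n)
        - x * exp (- x\<^sup>2 / 2) / sqrt (2 * pi) * (real k / real n)\<bar> \<le> 1 + ?c"
      using p[of "sqrt (real k) * \<sigma> * x / real n"] m[of "sqrt (real k) * \<sigma> * x / real n"]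
      by linarith
  qed
qed

end

theory Submission
  imports Defs
begin

text \<open>
  No Edgeworth expansion is needed, because only the difference of two very similar distribution
  functions is estimated. After rescaling by \<open>n / (sqrt k * \<sigma>)\<close> both increments are sums of two
  independent blocks of standardized variables. Writing \<open>g\<close> for their characteristic function,
  \<open>s = t / sqrt k\<close> and \<open>\<epsilon> = k / n\<close>, the increments have characteristic functions
  \<open>g(-s\<epsilon>/(1+\<epsilon>))^n * g(s/(1+\<epsilon>))^k\<close> and \<open>g(-s\<epsilon>/(1-\<epsilon>))^(n-k) * g(s)^k\<close>. The first factors differ
  only by \<open>O(\<epsilon>\<^sup>2t\<^sup>2)\<close>, so the main contribution is \<open>g(s/(1+\<epsilon>))^k - g(s)^k\<close>, which is asymptotic to
  \<open>\<epsilon> t\<^sup>2 exp(-t\<^sup>2/2)\<close>; divided by \<open>t\<close>, this is the Fourier counterpart of \<open>\<epsilon> x exp(-x\<^sup>2/2)/sqrt(2\<pi>)\<close>.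

  To pass back to distribution functions both laws are convolved with a normal law of standard
  deviation \<open>1/n\<close>. By Cramer's condition \<open>g(s)^k\<close> is exponentially small in \<open>k\<close> away from the origin, hence
  the convolved laws have uniformly bounded densities, and the convolution costs only
  \<open>O(1/n) = o(k/n)\<close>. As \<open>k\<close> grows like a power of \<open>n\<close>, the exponentially small terms also beat the powers of
  \<open>n\<close> that come from integrating the Gaussian factor over the tails.
\<close>

section \<open>Characteristic functions under moment and Cramer conditions\<close>

text \<open>Mean value inequality for \<open>iexp w - \<i> * w\<close> on \<open>{-c..c}\<close>:
  the derivative \<open>\<i> * (iexp w - 1)\<close> has modulus at most
  \<open>\<bar>w\<bar>\<close>. Expanding at \<open>y\<close> and at \<open>z\<close> separately
  would lose the factor \<open>\<bar>y - z\<bar>\<close>, which later supplies a power of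
  \<epsilon>.\<close>

lemma iexp_diff_bound1:
  fixes y z c :: real
  assumes "\<bar>y\<bar> \<le> c" "\<bar>z\<bar> \<le> c"
  shows "cmod (iexp y - iexp z - \<i> * (y - z)) \<le> \<bar>y - z\<bar> * c"
proof -
  have "norm ((\<lambda>w::real. iexp w - \<i> * w) y - (\<lambda>w::real. iexp w - \<i> * w) z) \<le> c * norm (y - z)"
  proof (rule differentiable_bound[where S = "{-c..c}" and f' = "\<lambda>w h. h *\<^sub>R (\<i> * iexp w - \<i>)"])
    fix w assume w: "w \<in> {-c..c}"
    have "((\<lambda>w::real. iexp w - \<i> * w) has_vector_derivative (\<i> * iexp w - \<i> * 1)) (at w within {-c..c})"
      by (intro derivative_intros) (auto intro!: derivative_eq_intros)
    then show "((\<lambda>w::real. iexp w - \<i> * w) has_derivative (\<lambda>h. h *\<^sub>R (\<i> * iexp w - \<i>))) (at w within {-c..c})"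
      by (simp add: has_vector_derivative_def)
    have "cmod (\<i> * iexp w - \<i>) = cmod (iexp w - 1)"
      by (metis (no_types) norm_mult norm_ii mult_1 right_diff_distrib mult.right_neutral)
    also have "\<dots> \<le> c" using iexp_approx1[of w 0] w by (auto)
    finally have le: "cmod (\<i> * iexp w - \<i>) \<le> c" .
    show "onorm (\<lambda>h. h *\<^sub>R (\<i> * iexp w - \<i>)) \<le> c"
      using le by (simp add: onorm_scaleR_left onorm_id)
  qed (use assms in auto)
  then show ?thesis by (simp add: algebra_simps)
qed

text \<open>The same argument one order higher: the derivative is
  \<open>\<i> * (iexp w - (1 + \<i> * w))\<close>, of modulus at most \<open>w\<^sup>2 / 2\<close>.
  The factor 1/2 is given away.\<close>

lemma iexp_diff_bound2:
  fixes y z c :: real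
  assumes "\<bar>y\<bar> \<le> c" "\<bar>z\<bar> \<le> c"
  shows "cmod (iexp y - iexp z - \<i> * (y - z) + (y\<^sup>2 - z\<^sup>2) / 2) \<le> \<bar>y - z\<bar> * c\<^sup>2"
proof -
  let ?f = "\<lambda>w::real. iexp w - \<i> * w + w\<^sup>2 / 2"
  have "norm (?f y - ?f z) \<le> c\<^sup>2 * norm (y - z)"
  proof (rule differentiable_bound[where S = "{-c..c}" and f' = "\<lambda>w h. h *\<^sub>R (\<i> * iexp w - \<i> + w)"])
    fix w assume w: "w \<in> {-c..c}"
    have sq: "((\<lambda>w::real. complex_of_real (w\<^sup>2 / 2)) has_vector_derivative complex_of_real w) (at w within {-c..c})"
      by (intro has_vector_derivative_of_real) (auto intro!: derivative_eq_intros)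
    have "((\<lambda>w::real. iexp w - \<i> * w) has_vector_derivative (\<i> * iexp w - \<i> * 1)) (at w within {-c..c})"
      by (intro derivative_intros) (auto intro!: derivative_eq_intros)
    from has_vector_derivative_add[OF this sq]
    show "(?f has_derivative (\<lambda>h. h *\<^sub>R (\<i> * iexp w - \<i> + w))) (at w within {-c..c})"
      by (simp add: has_vector_derivative_def)
    have "\<i> * iexp w - \<i> + w = \<i> * (iexp w - (1 + \<i> * w))"
      by (simp add: algebra_simps)
    then have "cmod (\<i> * iexp w - \<i> + w) = cmod (iexp w - (1 + \<i> * w))"
      by (metis norm_mult norm_ii mult_1)
    also have "\<dots> \<le> \<bar>w\<bar>\<^sup>2 / 2" using iexp_approx1[of w 1] by (simp add: numeral_2_eq_2)
    also have "\<dots> \<le> \<bar>w\<bar>\<^sup>2" by simp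
    also have "\<dots> \<le> c\<^sup>2" using w by (intro power_mono) auto
    finally have le: "cmod (\<i> * iexp w - \<i> + w) \<le> c\<^sup>2" .
    show "onorm (\<lambda>h. h *\<^sub>R (\<i> * iexp w - \<i> + w)) \<le> c\<^sup>2"
      using le by (simp add: onorm_scaleR_left onorm_id)
  qed (use assms in auto)
  then show ?thesis by (simp add: algebra_simps diff_divide_distrib)
qed

context real_distribution
begin

lemma integrable_iexp_mult [simp]: "integrable M (\<lambda>x. iexp (t * x))"
  by (intro integrable_const_bound[where B = 1]) (auto simp del: of_real_mult)

lemma char_diff_bound1:
  assumes 1: "integrable M (\<lambda>x. x)" "expectation (\<lambda>x. x) = 0"
    and 2: "integrable M (\<lambda>x. x\<^sup>2)" "expectation (\<lambda>x. x\<^sup>2) = 1"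
  shows "cmod (char M a - char M b) \<le> \<bar>a - b\<bar> * max \<bar>a\<bar> \<bar>b\<bar>"
proof -
  define c where "c = max \<bar>a\<bar> \<bar>b\<bar>"
  have c: "\<bar>a\<bar> \<le> c" "\<bar>b\<bar> \<le> c" by (auto simp: c_def)
  have int1: "integrable M complex_of_real" "(CLINT x|M. complex_of_real x) = 0"
    using 1 by simp_all
  have "(CLINT x|M. iexp (a * x) - iexp (b * x) - \<i> * (a - b) * of_real x) = char M a - char M b"
    using int1 by (simp add: char_def del: of_real_mult)
  then have "char M a - char M b = (CLINT x|M. iexp (a * x) - iexp (b * x) - \<i> * (a * x - b * x))"
    by (simp add: algebra_simps)
  also have "cmod \<dots> \<le> (\<integral>x. cmod (iexp (a * x) - iexp (b * x) - \<i> * (a * x - b * x)) \<partial>M)"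
    by (rule integral_norm_bound)
  also have "\<dots> \<le> (\<integral>x. \<bar>a - b\<bar> * c * x\<^sup>2 \<partial>M)"
  proof (rule integral_mono')
    fix x
    have "cmod (iexp (a * x) - iexp (b * x) - \<i> * (a * x - b * x)) \<le> \<bar>a * x - b * x\<bar> * (c * \<bar>x\<bar>)"
      using iexp_diff_bound1[of "a * x" "c * \<bar>x\<bar>" "b * x"] c
      by (simp add: abs_mult mult_right_mono)
    also have "\<dots> = \<bar>a - b\<bar> * c * x\<^sup>2"
      by (simp add: abs_mult power2_eq_square flip: left_diff_distrib)
    finally show "cmod (iexp (a * x) - iexp (b * x) - \<i> * (a * x - b * x)) \<le> \<bar>a - b\<bar> * c * x\<^sup>2" .
  qed (use 2 c in auto)
  also have "\<dots> = \<bar>a - b\<bar> * c" using 2 by simp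
  finally show ?thesis by (simp only: c_def)
qed

text \<open>The second order bound is integrated at \<open>a * x\<close> and \<open>b * x\<close>:
  the linear term has mean zero, the quadratic one contributes
  \<open>(a\<^sup>2 - b\<^sup>2) / 2\<close>, and the remainder is paid for by the third absolute
  moment.\<close>

lemma char_diff_bound2:
  assumes 1: "integrable M (\<lambda>x. x)" "expectation (\<lambda>x. x) = 0"
    and 2: "integrable M (\<lambda>x. x\<^sup>2)" "expectation (\<lambda>x. x\<^sup>2) = 1"
    and 3: "integrable M (\<lambda>x. \<bar>x\<bar> ^ 3)"
  shows "cmod (char M a - char M b + (a\<^sup>2 - b\<^sup>2) / 2) \<le> \<bar>a - b\<bar> * (max \<bar>a\<bar> \<bar>b\<bar>)\<^sup>2 * expectation (\<lambda>x. \<bar>x\<bar> ^ 3)"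
proof -
  define c where "c = max \<bar>a\<bar> \<bar>b\<bar>"
  have c: "\<bar>a\<bar> \<le> c" "\<bar>b\<bar> \<le> c" by (auto simp: c_def)
  let ?F = "\<lambda>x::real. iexp (a * x) - iexp (b * x) - \<i> * (a * x - b * x) + ((a * x)\<^sup>2 - (b * x)\<^sup>2) / 2"
  have int1: "integrable M complex_of_real" "(CLINT x|M. complex_of_real x) = 0"
    using 1 by simp_all
  have int2: "integrable M (\<lambda>x. complex_of_real (x\<^sup>2))" "(CLINT x|M. complex_of_real (x\<^sup>2)) = 1"
    using 2 by (simp_all del: of_real_power)
  have "(CLINT x|M. iexp (a * x) - iexp (b * x) - p * of_real x + q * of_real (x\<^sup>2))
      = char M a - char M b + q" for p q :: complex
    using int1 int2 by (simp add: char_def del: of_real_mult of_real_power)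
  from this[of "\<i> * (a - b)" "complex_of_real ((a\<^sup>2 - b\<^sup>2) / 2)"]
  have e1: "(CLINT x|M. iexp (a * x) - iexp (b * x) - \<i> * (a - b) * of_real x
        + complex_of_real ((a\<^sup>2 - b\<^sup>2) / 2) * of_real (x\<^sup>2)) = char M a - char M b + (a\<^sup>2 - b\<^sup>2) / 2" .
  have e2: "iexp (a * x) - iexp (b * x) - \<i> * (a - b) * of_real x
        + complex_of_real ((a\<^sup>2 - b\<^sup>2) / 2) * of_real (x\<^sup>2) = ?F x" for x
    by (simp add: power_mult_distrib algebra_simps diff_divide_distrib)
  have "(CLINT x|M. ?F x) = char M a - char M b + (a\<^sup>2 - b\<^sup>2) / 2"
    using e1 by (simp only: e2)
  then have "cmod (char M a - char M b + (a\<^sup>2 - b\<^sup>2) / 2) \<le> (\<integral>x. cmod (?F x) \<partial>M)"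
    using integral_norm_bound[of M ?F] by (simp only:)
  also have "\<dots> \<le> (\<integral>x. \<bar>a - b\<bar> * c\<^sup>2 * \<bar>x\<bar> ^ 3 \<partial>M)"
  proof (rule integral_mono')
    fix x
    have "cmod (?F x) \<le> \<bar>a * x - b * x\<bar> * (c * \<bar>x\<bar>)\<^sup>2"
      using iexp_diff_bound2[of "a * x" "c * \<bar>x\<bar>" "b * x"] c
      by (simp add: abs_mult mult_right_mono)
    also have "\<dots> = \<bar>a - b\<bar> * c\<^sup>2 * \<bar>x\<bar> ^ 3"
      by (simp add: abs_mult power2_eq_square power3_eq_cube flip: left_diff_distrib)
    finally show "cmod (?F x) \<le> \<bar>a - b\<bar> * c\<^sup>2 * \<bar>x\<bar> ^ 3" .
  qed (use 3 in auto)
  also have "\<dots> = \<bar>a - b\<bar> * c\<^sup>2 * expectation (\<lambda>x. \<bar>x\<bar> ^ 3)" by simp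
  finally show ?thesis by (simp only: c_def)
qed

section \<open>Decay of characteristic functions away from the origin\<close>

text \<open>After rotation by the argument \<theta> of \<open>char M u\<close>, both sides become
  expectations of cosines: \<open>cmod (char M u)\<close> is the mean of
  \<open>cos (u * x - \<theta>)\<close>, and the mean of \<open>cos (2 * (u * x - \<theta>))\<close>
  is at most \<open>cmod (char M (2 * u))\<close>. What remains is
  \<open>1 - cos (2 * v) \<le> 4 * (1 - cos v)\<close>, where the two sides differ by
  \<open>2 * (1 - cos v)\<^sup>2\<close>.\<close>

lemma cmod_char_double: "1 - cmod (char M (2 * u)) \<le> 4 * (1 - cmod (char M u))"
proof -
  define \<theta> where "\<theta> = Arg (char M u)"
  have Re_rot: "Re (cis (- \<phi>) * char M v) = expectation (\<lambda>x. cos (v * x - \<phi>))" for \<phi> v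
  proof -
    have "cis (- \<phi>) * char M v = (CLINT x|M. cis (- \<phi>) * iexp (v * x))"
      by (simp add: char_def)
    also have "Re \<dots> = expectation (\<lambda>x. Re (cis (- \<phi>) * iexp (v * x)))"
      by (rule integral_Re[symmetric]) (simp del: of_real_mult)
    also have "\<dots> = expectation (\<lambda>x. cos (v * x - \<phi>))"
      by (simp add: cis_conv_exp exp_add[symmetric] Re_exp algebra_simps flip: of_real_mult)
    finally show ?thesis .
  qed
  have int: "integrable M (\<lambda>x. cos (v * x - \<phi>))" for v \<phi>
    by (intro integrable_const_bound[where B = 1]) auto
  have "char M u = cmod (char M u) * cis \<theta>"
    using rcis_cmod_Arg[of "char M u"] by (simp add: rcis_def \<theta>_def)
  then have "cis (- \<theta>) * char M u = cmod (char M u)"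
    by (metis (no_types, lifting) cis_mult cis_zero add.left_inverse mult.left_commute mult.right_neutral)
  then have r: "cmod (char M u) = expectation (\<lambda>x. cos (u * x - \<theta>))"
    using Re_rot[of \<theta> u] by simp
  have "1 - cmod (char M (2 * u)) \<le> 1 - expectation (\<lambda>x. cos (2 * u * x - 2 * \<theta>))"
    using complex_Re_le_cmod[of "cis (- (2 * \<theta>)) * char M (2 * u)"] Re_rot[of "2 * \<theta>" "2 * u"]
    by (simp add: norm_mult)
  also have "\<dots> = expectation (\<lambda>x. 1 - cos (2 * (u * x - \<theta>)))"
    using int[of "2 * u" "2 * \<theta>"] prob_space by (simp add: algebra_simps)
  also have "\<dots> \<le> expectation (\<lambda>x. 4 * (1 - cos (u * x - \<theta>)))"
  proof (rule integral_mono)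
    fix x
    show "1 - cos (2 * (u * x - \<theta>)) \<le> 4 * (1 - cos (u * x - \<theta>))"
      using zero_le_power2[of "1 - cos (u * x - \<theta>)"]
      unfolding cos_double_cos by (simp add: power2_diff)
  qed (use int in \<open>auto simp: int right_diff_distrib simp flip: mult.assoc\<close>)
  also have "\<dots> = 4 * (1 - cmod (char M u))"
    using int prob_space by (simp add: r)
  finally show ?thesis .
qed

end

text \<open>
  Doubling \<open>u\<close> until it passes the threshold beyond which \<open>h \<le> \<rho>\<close> costs a factor 4 per step, that is a
  factor of order \<open>1/u\<^sup>2\<close> in total; so \<open>1 - h u\<close> is at least of order \<open>u\<^sup>2\<close> near the origin.
\<close>

lemma decay_of_doubling:
  fixes h :: "real \<Rightarrow> real"
  assumes h: "\<And>u. 0 \<le> h u" "\<And>u. h u \<le> 1"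
    and double: "\<And>u. 1 - h (2 * u) \<le> 4 * (1 - h u)"
    and lim: "eventually (\<lambda>t. h t \<le> r) at_infinity" "r < 1"
  obtains b \<rho> where "b > 0" "0 < \<rho>" "\<rho> < 1" "\<And>a j. h a ^ j \<le> exp (- (b * real j * a\<^sup>2)) + \<rho> ^ j"
proof -
  define \<rho> where "\<rho> = max r (1 / 2)"
  have \<rho>: "0 < \<rho>" "\<rho> < 1" using lim by (auto simp: \<rho>_def)
  obtain T0 where T0: "\<And>t. T0 \<le> norm t \<Longrightarrow> h t \<le> r"
    using lim(1) unfolding eventually_at_infinity by auto
  define T where "T = max T0 1"
  have T: "T > 0" "\<And>t. T \<le> \<bar>t\<bar> \<Longrightarrow> h t \<le> \<rho>"
  proof -
    show "h t \<le> \<rho>" if "T \<le> \<bar>t\<bar>" for t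
      using T0[of t] that by (simp add: T_def \<rho>_def)
  qed (simp add: T_def)
  have iter: "1 - h (2 ^ j * u) \<le> 4 ^ j * (1 - h u)" for j u
  proof (induction j)
    case (Suc j)
    have "1 - h (2 ^ Suc j * u) \<le> 4 * (1 - h (2 ^ j * u))"
      using double[of "2 ^ j * u"] by (simp add: mult_ac)
    with Suc show ?case by simp
  qed simp
  \<comment> \<open>The first doubling past \<open>T\<close> overshoots it by at most a factor 2, so
    \<open>2 ^ j * \<bar>u\<bar> \<le> 2 * T\<close>; this gives the 4 in the denominator.\<close>
  define b where "b = (1 - \<rho>) / (4 * T\<^sup>2)"
  have b: "b > 0" using \<rho> T by (simp add: b_def)
  have small: "h u \<le> 1 - b * u\<^sup>2" if u: "\<bar>u\<bar> \<le> T" for u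
  proof (cases "u = 0")
    case False
    have ex: "\<exists>j. T \<le> 2 ^ j * \<bar>u\<bar>"
    proof -
      obtain j where "T / \<bar>u\<bar> < 2 ^ j" using real_arch_pow[of 2 "T / \<bar>u\<bar>"] by auto
      then show ?thesis using False by (auto simp: field_simps intro!: exI[of _ j])
    qed
    define j where "j = (LEAST j. T \<le> 2 ^ j * \<bar>u\<bar>)"
    have j1: "T \<le> 2 ^ j * \<bar>u\<bar>" unfolding j_def by (rule LeastI_ex[OF ex])
    have j2: "2 ^ j * \<bar>u\<bar> \<le> 2 * T"
    proof (cases j)
      case (Suc i)
      then have "\<not> T \<le> 2 ^ i * \<bar>u\<bar>" using not_less_Least[of i "\<lambda>j. T \<le> 2 ^ j * \<bar>u\<bar>"] by (simp add: j_def)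
      then show ?thesis using Suc by simp
    qed (use u T in auto)
    have four: "(4::real) ^ j = (2 ^ j)\<^sup>2"
      by (simp add: power2_eq_square flip: power_mult_distrib)
    have "1 - \<rho> \<le> 4 ^ j * (1 - h u)"
      using iter[of j u] T(2)[of "2 ^ j * u"] j1 by (simp add: abs_mult)
    then have "(1 - \<rho>) * u\<^sup>2 \<le> 4 ^ j * (1 - h u) * u\<^sup>2" by (rule mult_right_mono) simp
    also have "\<dots> = (2 ^ j * \<bar>u\<bar>)\<^sup>2 * (1 - h u)"
      by (simp only: four power_mult_distrib power2_abs mult_ac)
    also have "\<dots> \<le> (2 * T)\<^sup>2 * (1 - h u)"
      using j2 h(2)[of u] by (intro mult_right_mono power_mono) auto
    finally show ?thesis using T by (simp add: b_def field_simps)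
  qed (use h in simp)
  have "h a ^ j \<le> exp (- (b * real j * a\<^sup>2)) + \<rho> ^ j" for a j
  proof (cases "\<bar>a\<bar> \<le> T")
    case True
    have "h a \<le> exp (- (b * a\<^sup>2))"
      using small[OF True] exp_ge_add_one_self[of "- (b * a\<^sup>2)"] by linarith
    then have "h a ^ j \<le> exp (- (b * a\<^sup>2)) ^ j" using h by (intro power_mono) auto
    also have "\<dots> = exp (- (b * real j * a\<^sup>2))"
      by (simp add: exp_of_nat_mult[symmetric] algebra_simps)
    finally show ?thesis using \<rho> by (simp add: add_increasing2)
  next
    case False
    then have "h a ^ j \<le> \<rho> ^ j" using h T by (intro power_mono) auto
    then show ?thesis by (simp add: add_increasing)
  qed
  then show thesis using that b \<rho> by blast
qed

section \<open>Gaussian smoothing of distribution functions\<close>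

text \<open>The product weight makes \<open>h\<close> integrable on the product space, so all three
  claims are Fubini's theorem under a domination that can be checked pointwise.\<close>

lemma (in pair_sigma_finite) Fubini_dominated:
  fixes h :: "'a \<Rightarrow> 'b \<Rightarrow> real"
  assumes meas: "case_prod h \<in> borel_measurable (M1 \<Otimes>\<^sub>M M2)"
    and w: "integrable M1 w1" "integrable M2 w2"
    and bound: "\<And>a t. \<bar>h a t\<bar> \<le> w1 a * w2 t"
  shows "(\<integral>a. (\<integral>t. h a t \<partial>M2) \<partial>M1) = (\<integral>t. (\<integral>a. h a t \<partial>M1) \<partial>M2)"
    and "integrable M1 (\<lambda>a. \<integral>t. h a t \<partial>M2)"
    and "integrable M2 (\<lambda>t. \<integral>a. h a t \<partial>M1)"
proof -
  note [measurable] = meas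
  have w0: "0 \<le> w1 a * w2 t" for a t using bound[of a t] by linarith
  have int: "integrable M2 (h a)" if "a \<in> space M1" for a
  proof (rule Bochner_Integration.integrable_bound)
    show "integrable M2 (\<lambda>t. w1 a * w2 t)" using w by simp
    show "h a \<in> borel_measurable M2"
      using measurable_compose[OF measurable_Pair1'[OF that] meas] by simp
  qed (use bound[of a] w0[of a] in \<open>auto\<close>)
  have prod: "integrable (M1 \<Otimes>\<^sub>M M2) (case_prod h)"
  proof (rule Fubini_integrable[OF meas])
    show "integrable M1 (\<lambda>x. \<integral>y. norm (case_prod h (x, y)) \<partial>M2)"
    proof (rule Bochner_Integration.integrable_bound)
      show "integrable M1 (\<lambda>a. w1 a * (\<integral>t. w2 t \<partial>M2))" using w by simp
      show "AE a in M1. norm (\<integral>y. norm (case_prod h (a, y)) \<partial>M2) \<le> norm (w1 a * (\<integral>t. w2 t \<partial>M2))"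
      proof (rule AE_I2)
        fix a assume a: "a \<in> space M1"
        have "(\<integral>y. norm (case_prod h (a, y)) \<partial>M2) \<le> (\<integral>t. w1 a * w2 t \<partial>M2)"
          using w int[OF a] bound by (intro integral_mono) auto
        then show "norm (\<integral>y. norm (case_prod h (a, y)) \<partial>M2) \<le> norm (w1 a * (\<integral>t. w2 t \<partial>M2))"
          by simp
      qed
    qed simp
  qed (use int in auto)
  show "(\<integral>a. (\<integral>t. h a t \<partial>M2) \<partial>M1) = (\<integral>t. (\<integral>a. h a t \<partial>M1) \<partial>M2)"
    using Fubini_integral[OF prod] by simp
  show "integrable M1 (\<lambda>a. \<integral>t. h a t \<partial>M2)"
    using integrable_fst'[OF prod] by simp
  show "integrable M2 (\<lambda>t. \<integral>a. h a t \<partial>M1)"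
    using integrable_snd[OF prod] by simp
qed

lemma integrable_abs_power_gauss:
  assumes "c > 0"
  shows "integrable lborel (\<lambda>t::real. \<bar>t\<bar> ^ j * exp (- (c * t\<^sup>2)))"
proof -
  have "integrable lborel (\<lambda>t. sqrt (pi / c) * (normal_density 0 (1 / sqrt (2 * c)) t * \<bar>t - 0\<bar> ^ j))"
    using assms by (intro integrable_mult_right integrable_normal_moment_abs) simp
  also have "(\<lambda>t. sqrt (pi / c) * (normal_density 0 (1 / sqrt (2 * c)) t * \<bar>t - 0\<bar> ^ j))
      = (\<lambda>t. \<bar>t\<bar> ^ j * exp (- (c * t\<^sup>2)))"
    using assms by (auto simp: normal_density_def power_divide)
  finally show ?thesis .
qed

text \<open>Substitution of \<open>\<delta> * t\<close>. For \<open>\<delta> = 1 / n\<close> the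
  smoothing factor has width of order \<open>n\<close>, and the integral grows like
  \<open>n ^ (j + 1)\<close>.\<close>

lemma gauss_scale:
  assumes "\<delta> > 0"
  shows "integrable lborel (\<lambda>t::real. \<bar>t\<bar> ^ j * exp (- (\<delta> * t)\<^sup>2 / 2))"
    and "(\<integral>t. \<bar>t\<bar> ^ j * exp (- (\<delta> * t)\<^sup>2 / 2) \<partial>lborel)
      = (\<integral>t. \<bar>t\<bar> ^ j * exp (- t\<^sup>2 / 2) \<partial>lborel) / \<delta> ^ Suc j"
proof -
  show "integrable lborel (\<lambda>t::real. \<bar>t\<bar> ^ j * exp (- (\<delta> * t)\<^sup>2 / 2))"
    using integrable_abs_power_gauss[of "\<delta>\<^sup>2 / 2" j] assms by (simp add: power_mult_distrib)
  have "(\<integral>t. \<bar>t\<bar> ^ j * exp (- t\<^sup>2 / 2) \<partial>lborel)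
      = \<delta> * (\<integral>t. \<bar>\<delta> * t\<bar> ^ j * exp (- (\<delta> * t)\<^sup>2 / 2) \<partial>lborel)"
    using lborel_integral_real_affine[of \<delta> "\<lambda>t. \<bar>t\<bar> ^ j * exp (- t\<^sup>2 / 2)" 0] assms by simp
  also have "\<dots> = \<delta> ^ Suc j * (\<integral>t. \<bar>t\<bar> ^ j * exp (- (\<delta> * t)\<^sup>2 / 2) \<partial>lborel)"
    using assms by (simp add: abs_mult power_mult_distrib mult.assoc)
  finally show "(\<integral>t. \<bar>t\<bar> ^ j * exp (- (\<delta> * t)\<^sup>2 / 2) \<partial>lborel)
      = (\<integral>t. \<bar>t\<bar> ^ j * exp (- t\<^sup>2 / 2) \<partial>lborel) / \<delta> ^ Suc j"
    using assms by simp
qed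

lemma integral_cos_gauss:
  "(\<integral>t. cos (y * t) * exp (- t\<^sup>2 / 2) \<partial>lborel) = sqrt (2 * pi) * exp (- y\<^sup>2 / 2)"
proof -
  have "exp (- y\<^sup>2 / 2) = Re (char std_normal_distribution y)"
    by (simp add: char_std_normal_distribution)
  also have "\<dots> = (\<integral>t. cos (y * t) \<partial>std_normal_distribution)"
  proof -
    interpret real_distribution std_normal_distribution by (rule real_dist_normal_dist)
    have "integrable std_normal_distribution (\<lambda>x. iexp (y * x))"
      by (intro integrable_const_bound[where B = 1]) (auto simp del: of_real_mult)
    then show ?thesis
      unfolding char_def by (subst integral_Re[symmetric]) (auto simp: Re_exp)
  qed
  also have "\<dots> = (\<integral>t. std_normal_density t * cos (y * t) \<partial>lborel)"
    by (subst integral_density) auto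
  also have "\<dots> = (\<integral>t. cos (y * t) * exp (- t\<^sup>2 / 2) \<partial>lborel) / sqrt (2 * pi)"
    by (simp add: std_normal_density_def mult.commute)
  finally show ?thesis by (simp add: field_simps)
qed

text \<open>Integration by parts: \<open>?f\<close> is the derivative of
  \<open>- exp (- t\<^sup>2 / 2) * sin (x * t)\<close>, which vanishes at both infinities, so the
  sine integral is \<open>x\<close> times the cosine integral. This is the Fourier form of the main
  term.\<close>

lemma integral_sin_gauss:
  "(\<integral>t. sin (x * t) * t * exp (- t\<^sup>2 / 2) \<partial>lborel) = sqrt (2 * pi) * x * exp (- x\<^sup>2 / 2)"
proof -
  let ?F = "\<lambda>t. - exp (- t\<^sup>2 / 2) * sin (x * t)"
  let ?f = "\<lambda>t. sin (x * t) * t * exp (- t\<^sup>2 / 2) - x * (cos (x * t) * exp (- t\<^sup>2 / 2))"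
  have i1: "integrable lborel (\<lambda>t. sin (x * t) * t * exp (- t\<^sup>2 / 2))"
    using gauss_scale(1)[of 1 1]
    by (rule Bochner_Integration.integrable_bound) (auto simp: abs_mult mult_left_le_one_le mult_right_mono)
  have i2: "integrable lborel (\<lambda>t. cos (x * t) * exp (- t\<^sup>2 / 2))"
    using gauss_scale(1)[of 1 0]
    by (rule Bochner_Integration.integrable_bound) (auto simp: abs_mult mult_left_le_one_le)
  have int: "integrable lborel ?f" using i1 i2 by simp
  have lim: "((\<lambda>t::real. exp (- t\<^sup>2 / 2)) \<longlongrightarrow> 0) at_top" "((\<lambda>t::real. exp (- t\<^sup>2 / 2)) \<longlongrightarrow> 0) at_bot"
    by real_asymp+
  have "(LBINT t=-\<infinity>..\<infinity>. ?f t) = 0 - 0"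
  proof (rule interval_integral_FTC_integrable)
    fix t
    show "(?F has_vector_derivative ?f t) (at t)"
      unfolding has_real_derivative_iff_has_vector_derivative[symmetric]
      by (auto intro!: derivative_eq_intros simp: algebra_simps)
    show "isCont ?f t" by (intro continuous_intros) auto
  next
    show "set_integrable lborel (einterval (-\<infinity>) \<infinity>) ?f"
      using int by (simp add: set_integrable_def)
    have c: "\<bar>?F t\<bar> \<le> exp (- t\<^sup>2 / 2)" for t
      by (simp add: abs_mult mult_left_le)
    have "(?F \<longlongrightarrow> 0) at_top"
      by (rule Lim_null_comparison[OF _ lim(1)]) (use c in auto)
    then show "((?F \<circ> real_of_ereal) \<longlongrightarrow> 0) (at_left \<infinity>)"
      by (simp add: ereal_tendsto_simps1)
    have "(?F \<longlongrightarrow> 0) at_bot"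
      by (rule Lim_null_comparison[OF _ lim(2)]) (use c in auto)
    then show "((?F \<circ> real_of_ereal) \<longlongrightarrow> 0) (at_right (-\<infinity>))"
      by (simp add: ereal_tendsto_simps1)
  qed simp
  then have "(\<integral>t. ?f t \<partial>lborel) = 0"
    by (simp add: interval_lebesgue_integral_def set_lebesgue_integral_def)
  then show ?thesis
    using i1 i2 by (simp add: integral_cos_gauss[simplified])
qed

text \<open>
  This is \<open>\<Phi>(v) - 1/2\<close> for the standard normal distribution function \<open>\<Phi>\<close>. The centring makes the Fourier
  integral converge absolutely; the junk value of the integrand at \<open>t = 0\<close> is irrelevant.
\<close>

definition gauss_err :: "real \<Rightarrow> real" where
  "gauss_err v = (\<integral>t. sin (v * t) / t * exp (- t\<^sup>2 / 2) \<partial>lborel) / (2 * pi)"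

lemma abs_sin_over_le: "\<bar>sin (v * t) / t\<bar> \<le> \<bar>v\<bar>" for v t :: real
  using abs_sin_x_le_abs_x[of "v * t"]
  by (cases "t = 0") (auto simp: abs_mult divide_simps)

lemma gauss_err_minus: "gauss_err (- v) = - gauss_err v"
  by (simp add: gauss_err_def)

lemma integral_gauss_half:
  "(\<integral>y. indicator {0..} y * std_normal_density y \<partial>lborel) = 1 / 2"
proof -
  let ?d = std_normal_density
  have int: "integrable lborel (\<lambda>y. indicator A y * ?d y)" if "A \<in> sets borel" for A
    using integrable_mult_indicator[of A lborel ?d] that by simp
  have "(\<integral>y. indicator {..0} y * ?d y \<partial>lborel) = (\<integral>y. indicator {0..} y * ?d y \<partial>lborel)"
    using lborel_integral_real_affine[of "-1" "\<lambda>y. indicator {..0} y * ?d y" 0]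
    by (auto simp: std_normal_density_def indicator_def intro!: Bochner_Integration.integral_cong)
  moreover have "(\<integral>y. indicator {..0} y * ?d y \<partial>lborel) + (\<integral>y. indicator {0..} y * ?d y \<partial>lborel)
      = (\<integral>y. indicator {..0} y * ?d y + indicator {0..} y * ?d y \<partial>lborel)"
    using int by simp
  \<comment> \<open>The two half-lines overlap only at 0, a null set.\<close>
  moreover have "\<dots> = (\<integral>y. ?d y \<partial>lborel)"
    using AE_lborel_singleton[of "0::real"]
    by (intro integral_cong_AE) (auto simp: indicator_def)
  ultimately show ?thesis by simp
qed

text \<open>The density is written as its own cosine transform, the integrals are swapped, and
  \<open>cos (y * t)\<close> is integrated over \<open>y\<close> in \<open>{0..v}\<close>, which
  gives \<open>sin (v * t) / t\<close> except at \<open>t = 0\<close>.\<close>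

lemma gauss_err_eq:
  assumes "v \<ge> 0"
  shows "gauss_err v = (\<integral>y. indicator {0..v} y * std_normal_density y \<partial>lborel)"
proof -
  have "2 * pi * std_normal_density y = sqrt (2 * pi) * exp (- y\<^sup>2 / 2)" for y
    unfolding std_normal_density_def mult.assoc[symmetric] times_divide_eq_right
    using real_div_sqrt[of "2 * pi"] by simp
  then have "indicator {0..v} y * (sqrt (2 * pi) * exp (- y\<^sup>2 / 2))
      = 2 * pi * (indicator {0..v} y * std_normal_density y)" for y
    by (metis mult.left_commute)
  then have "2 * pi * (\<integral>y. indicator {0..v} y * std_normal_density y \<partial>lborel)
      = (\<integral>y. indicator {0..v} y * (sqrt (2 * pi) * exp (- y\<^sup>2 / 2)) \<partial>lborel)"
    by (simp only: integral_mult_right_zero)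
  also have "\<dots>
      = (\<integral>y. (\<integral>t. indicator {0..v} y * (cos (y * t) * exp (- t\<^sup>2 / 2)) \<partial>lborel) \<partial>lborel)"
    by (simp add: integral_cos_gauss[simplified])
  also have "\<dots> = (\<integral>t. (\<integral>y. indicator {0..v} y * (cos (y * t) * exp (- t\<^sup>2 / 2)) \<partial>lborel) \<partial>lborel)"
  proof (rule lborel_pair.Fubini_dominated(1))
    show "integrable lborel (indicator {0..v} :: real \<Rightarrow> real)"
      using emeasure_lborel_Icc[OF assms] by (intro integrable_real_indicator) auto
    show "integrable lborel (\<lambda>t::real. exp (- t\<^sup>2 / 2))"
      using gauss_scale(1)[of 1 0] by simp
    fix a t
    show "\<bar>indicator {0..v} a * (cos (a * t) * exp (- t\<^sup>2 / 2))\<bar> \<le> indicator {0..v} a * exp (- t\<^sup>2 / 2)"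
      by (auto simp: abs_mult indicator_def)
  qed simp
  also have "\<dots> = (\<integral>t. sin (v * t) / t * exp (- t\<^sup>2 / 2) \<partial>lborel)"
  proof (rule integral_cong_AE)
    show "AE t in lborel. (\<integral>y. indicator {0..v} y * (cos (y * t) * exp (- t\<^sup>2 / 2)) \<partial>lborel)
        = sin (v * t) / t * exp (- t\<^sup>2 / 2)"
      using AE_lborel_singleton[of "0::real"]
    proof eventually_elim
      case (elim t)
      have "(\<integral>y. indicator {0..v} y *\<^sub>R cos (y * t) \<partial>lborel) = sin (v * t) / t - sin (0 * t) / t"
        using assms elim
        by (intro integral_FTC_atLeastAtMost)
           (auto intro!: derivative_eq_intros continuous_intros simp flip: has_real_derivative_iff_has_vector_derivative)
      then show ?case by (simp add: mult_ac flip: mult.assoc)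
    qed
  qed simp_all
  finally show ?thesis
    by (simp add: gauss_err_def field_simps)
qed

text \<open>The difference is the normal mass above \<open>v\<close>. Shifting it to the origin and
  using \<open>(v + y)\<^sup>2 \<ge> v\<^sup>2 + y\<^sup>2\<close> for nonnegative \<open>v\<close>
  and \<open>y\<close> splits off the factor \<open>exp (- v\<^sup>2 / 2)\<close>; the mass 1/2 of a
  half-line remains.\<close>

lemma gauss_err_tail:
  assumes "v \<ge> 0"
  shows "\<bar>1 / 2 - gauss_err v\<bar> \<le> exp (- v\<^sup>2 / 2) / 2"
proof -
  let ?d = std_normal_density
  have int: "integrable lborel (\<lambda>y. indicator A y * ?d y)" if "A \<in> sets borel" for A
    using integrable_mult_indicator[of A lborel ?d] that by simp
  have "(\<integral>y. indicator {v<..} y * ?d y \<partial>lborel)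
      = (\<integral>y. indicator {0..} y * ?d y - indicator {0..v} y * ?d y \<partial>lborel)"
    using assms by (intro Bochner_Integration.integral_cong) (auto simp: indicator_def)
  also have "\<dots> = 1 / 2 - gauss_err v"
    using int by (simp add: integral_gauss_half gauss_err_eq[OF assms])
  finally have eq: "1 / 2 - gauss_err v = (\<integral>y. indicator {v<..} y * ?d y \<partial>lborel)" ..
  also have "\<dots> = (\<integral>y. indicator {v<..} (v + y) * ?d (v + y) \<partial>lborel)"
    using lborel_integral_real_affine[of 1 "\<lambda>y. indicator {v<..} y * ?d y" v] by simp
  also have "\<dots> \<le> (\<integral>y. exp (- v\<^sup>2 / 2) * (indicator {0..} y * ?d y) \<partial>lborel)"
  proof (rule integral_mono')
    show "integrable lborel (\<lambda>y. exp (- v\<^sup>2 / 2) * (indicator {0..} y * ?d y))"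
      using int by simp
    fix y :: real
    show "indicator {v<..} (v + y) * ?d (v + y) \<le> exp (- v\<^sup>2 / 2) * (indicator {0..} y * ?d y)"
    proof (cases "y > 0")
      case True
      then have "- (v + y)\<^sup>2 / 2 \<le> - v\<^sup>2 / 2 + - y\<^sup>2 / 2"
        using assms by (simp add: power2_sum)
      then have "exp (- (v + y)\<^sup>2 / 2) \<le> exp (- v\<^sup>2 / 2) * exp (- y\<^sup>2 / 2)"
        by (simp add: exp_add[symmetric])
      then show ?thesis using True by (simp add: std_normal_density_def divide_right_mono)
    qed (simp add: indicator_def)
  qed simp
  also have "\<dots> = exp (- v\<^sup>2 / 2) / 2" by (simp add: integral_gauss_half)
  finally have "1 / 2 - gauss_err v \<le> exp (- v\<^sup>2 / 2) / 2" .
  moreover have "0 \<le> 1 / 2 - gauss_err v"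
    unfolding eq by (intro Bochner_Integration.integral_nonneg) simp
  ultimately show ?thesis by simp
qed

text \<open>For negative \<open>u\<close> the odd symmetry of \<open>gauss_err\<close> reduces the
  claim to the tail bound at \<open>- u\<close>. The right side is Gaussian on purpose: its
  expectation can again be written as a Fourier integral.\<close>

lemma step_minus_gauss_err:
  "\<bar>indicator {0..} u - 1 / 2 - gauss_err u\<bar> \<le> exp (- u\<^sup>2 / 2) / 2"
  using gauss_err_tail[of u] gauss_err_tail[of "- u"]
  by (cases "u \<ge> 0") (auto simp: gauss_err_minus abs_if split: if_splits)

section \<open>The smoothing inequality\<close>

context real_distribution
begin

lemma integral_iexp_shift:
  "(CLINT a|M. iexp (t * (x - a))) = iexp (t * x) * cnj (char M t)"
proof -
  have "iexp (t * (x - a)) = iexp (t * x) * cnj (iexp (t * a))" for a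
    by (simp add: exp_cnj exp_add[symmetric] algebra_simps)
  then show ?thesis
    by (simp only: integral_mult_right_zero Bochner_Integration.integral_cnj char_def)
qed

lemma integral_sin_shift: "expectation (\<lambda>a. sin (t * (x - a))) = Im (iexp (t * x) * cnj (char M t))"
  and integral_cos_shift: "expectation (\<lambda>a. cos (t * (x - a))) = Re (iexp (t * x) * cnj (char M t))"
proof -
  have Im_iexp: "Im (iexp y) = sin y" and Re_iexp: "Re (iexp y) = cos y" for y
    by (simp_all add: Im_exp Re_exp)
  have int: "integrable M (\<lambda>a. iexp (t * (x - a)))"
    by (intro integrable_const_bound[where B = 1]) (auto simp del: of_real_mult of_real_diff)
  show "expectation (\<lambda>a. sin (t * (x - a))) = Im (iexp (t * x) * cnj (char M t))"
    using integral_Im[OF int] by (simp only: Im_iexp integral_iexp_shift)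
  show "expectation (\<lambda>a. cos (t * (x - a))) = Re (iexp (t * x) * cnj (char M t))"
    using integral_Re[OF int] by (simp only: Re_iexp integral_iexp_shift)
qed

text \<open>The Fourier term is the expectation of \<open>gauss_err ((x - a) / \<delta>)\<close>,
  that is, the distribution function at \<open>x\<close> of \<open>M\<close> convolved with a normal
  law of standard deviation \<delta>, minus 1/2. The right side is, up to a constant, \<delta> times
  the Fourier bound on the density of that smoothed law.\<close>

lemma cdf_smoothing:
  assumes int: "integrable M (\<lambda>a. a)" and \<delta>: "\<delta> > 0"
  shows "\<bar>cdf M x - 1 / 2
      - (\<integral>t. Im (iexp (t * x) * cnj (char M t)) / t * exp (- (\<delta> * t)\<^sup>2 / 2) \<partial>lborel) / (2 * pi)\<bar>
    \<le> \<delta> * (\<integral>t. cmod (char M t) * exp (- (\<delta> * t)\<^sup>2 / 2) \<partial>lborel)"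
    and "integrable lborel (\<lambda>t. Im (iexp (t * x) * cnj (char M t)) / t * exp (- (\<delta> * t)\<^sup>2 / 2))"
proof -
  let ?e = "\<lambda>t. exp (- (\<delta> * t)\<^sup>2 / 2)"
  interpret pair_sigma_finite M "lborel :: real measure" ..
  have int_e: "integrable lborel ?e"
    using gauss_scale(1)[OF \<delta>, of 0] by simp
  have err: "gauss_err (u / \<delta>) = (\<integral>t. sin (t * u) / t * ?e t \<partial>lborel) / (2 * pi)" for u
  proof -
    have "(\<integral>t. sin (u / \<delta> * t) / t * exp (- t\<^sup>2 / 2) \<partial>lborel)
        = \<delta> * (\<integral>t. sin (u / \<delta> * (\<delta> * t)) / (\<delta> * t) * exp (- (\<delta> * t)\<^sup>2 / 2) \<partial>lborel)"
      using lborel_integral_real_affine[of \<delta> "\<lambda>t. sin (u / \<delta> * t) / t * exp (- t\<^sup>2 / 2)" 0] \<delta> by simp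
    also have "\<dots> = (\<integral>t. \<delta> * (sin (u / \<delta> * (\<delta> * t)) / (\<delta> * t) * exp (- (\<delta> * t)\<^sup>2 / 2)) \<partial>lborel)"
      by (rule integral_mult_right_zero[symmetric])
    also have "\<dots> = (\<integral>t. sin (t * u) / t * ?e t \<partial>lborel)"
      using \<delta> by (intro Bochner_Integration.integral_cong) (auto simp: mult.commute)
    finally show ?thesis by (simp add: gauss_err_def)
  qed
  have kernel: "exp (- (u / \<delta>)\<^sup>2 / 2) = \<delta> / sqrt (2 * pi) * (\<integral>t. cos (t * u) * ?e t \<partial>lborel)" for u
  proof -
    have "sqrt (2 * pi) * exp (- (u / \<delta>)\<^sup>2 / 2) = (\<integral>t. cos (u / \<delta> * t) * exp (- t\<^sup>2 / 2) \<partial>lborel)"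
      by (rule integral_cos_gauss[symmetric])
    also have "\<dots> = \<delta> * (\<integral>t. cos (u / \<delta> * (\<delta> * t)) * ?e t \<partial>lborel)"
      using lborel_integral_real_affine[of \<delta> "\<lambda>t. cos (u / \<delta> * t) * exp (- t\<^sup>2 / 2)" 0] \<delta> by simp
    also have "\<dots> = \<delta> * (\<integral>t. cos (t * u) * ?e t \<partial>lborel)"
      using \<delta> by (simp add: mult.commute)
    finally show ?thesis by (simp add: field_simps)
  qed
  have int_w: "integrable M (\<lambda>a. \<bar>x\<bar> + \<bar>a\<bar>)"
    using int by (intro Bochner_Integration.integrable_add integrable_abs) auto
  \<comment> \<open>Since \<open>\<bar>sin (t * u) / t\<bar> \<le> \<bar>u\<bar>\<close>, the
    division by \<open>t\<close> is harmless; the weight is integrable because \<open>M\<close> has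
    a first moment.\<close>
  have bound: "\<bar>sin (t * (x - a)) / t * ?e t\<bar> \<le> (\<bar>x\<bar> + \<bar>a\<bar>) * ?e t" for a t
  proof -
    have "\<bar>sin (t * (x - a)) / t\<bar> \<le> \<bar>x - a\<bar>"
      using abs_sin_over_le[of "x - a" t] by (simp add: mult.commute)
    also have "\<dots> \<le> \<bar>x\<bar> + \<bar>a\<bar>" by simp
    finally have "\<bar>sin (t * (x - a)) / t\<bar> * ?e t \<le> (\<bar>x\<bar> + \<bar>a\<bar>) * ?e t"
      by (rule mult_right_mono) simp
    then show ?thesis by (simp add: abs_mult)
  qed
  have meas1: "(\<lambda>(a, t). sin (t * (x - a)) / t * ?e t) \<in> borel_measurable (M \<Otimes>\<^sub>M lborel)"
    and meas2: "(\<lambda>(a, t). cos (t * (x - a)) * ?e t) \<in> borel_measurable (M \<Otimes>\<^sub>M lborel)"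
    by measurable
  have swap1: "expectation (\<lambda>a. \<integral>t. sin (t * (x - a)) / t * ?e t \<partial>lborel)
      = (\<integral>t. Im (iexp (t * x) * cnj (char M t)) / t * ?e t \<partial>lborel)"
    using Fubini_dominated(1)[OF meas1 int_w int_e bound]
    by (simp only: integral_divide_zero integral_mult_left_zero integral_sin_shift)
  have int1: "integrable M (\<lambda>a. \<integral>t. sin (t * (x - a)) / t * ?e t \<partial>lborel)"
    by (rule Fubini_dominated(2)[OF meas1 int_w int_e bound])
  have int_c: "integrable M (\<lambda>a. 1::real)" by simp
  have bound2: "\<bar>cos (t * (x - a)) * ?e t\<bar> \<le> 1 * ?e t" for a t
    by (simp add: abs_mult)
  have swap2: "expectation (\<lambda>a. \<integral>t. cos (t * (x - a)) * ?e t \<partial>lborel)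
      = (\<integral>t. Re (iexp (t * x) * cnj (char M t)) * ?e t \<partial>lborel)"
    using Fubini_dominated(1)[OF meas2 int_c int_e bound2]
    by (simp only: integral_mult_left_zero integral_cos_shift)
  have int2: "integrable M (\<lambda>a. \<integral>t. cos (t * (x - a)) * ?e t \<partial>lborel)"
    by (rule Fubini_dominated(2)[OF meas2 int_c int_e bound2])
  have int_err: "integrable M (\<lambda>a. gauss_err ((x - a) / \<delta>))"
    using int1 by (simp add: err)
  have E_err: "expectation (\<lambda>a. gauss_err ((x - a) / \<delta>))
      = (\<integral>t. Im (iexp (t * x) * cnj (char M t)) / t * ?e t \<partial>lborel) / (2 * pi)"
    by (simp only: err swap1 integral_divide_zero)
  have int_k: "integrable M (\<lambda>a. exp (- ((x - a) / \<delta>)\<^sup>2 / 2))"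
    unfolding kernel using int2 by (rule integrable_mult_right)
  have E_k: "expectation (\<lambda>a. exp (- ((x - a) / \<delta>)\<^sup>2 / 2))
      = \<delta> / sqrt (2 * pi) * (\<integral>t. Re (iexp (t * x) * cnj (char M t)) * ?e t \<partial>lborel)"
    by (simp only: kernel swap2 integral_mult_right_zero)
  have ind: "indicator {0..} ((x - a) / \<delta>) = (indicator {..x} a :: real)" for a
    using \<delta> by (auto simp: indicator_def zero_le_divide_iff)
  have cdf: "cdf M x = expectation (\<lambda>a. indicator {0..} ((x - a) / \<delta>))"
    by (simp add: ind cdf_def)
  have int_ind: "integrable M (\<lambda>a. indicator {0..} ((x - a) / \<delta>) :: real)"
    unfolding ind by (intro integrable_const_bound[where B = 1]) (auto split: split_indicator)
  have "cdf M x - 1 / 2 - (\<integral>t. Im (iexp (t * x) * cnj (char M t)) / t * ?e t \<partial>lborel) / (2 * pi)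
      = expectation (\<lambda>a. indicator {0..} ((x - a) / \<delta>) - 1 / 2 - gauss_err ((x - a) / \<delta>))"
    unfolding cdf E_err[symmetric] using int_ind int_err prob_space by simp
  then have "\<bar>cdf M x - 1 / 2 - (\<integral>t. Im (iexp (t * x) * cnj (char M t)) / t * ?e t \<partial>lborel) / (2 * pi)\<bar>
      \<le> expectation (\<lambda>a. \<bar>indicator {0..} ((x - a) / \<delta>) - 1 / 2 - gauss_err ((x - a) / \<delta>)\<bar>)"
    by (simp only: integral_abs_bound)
  \<comment> \<open>The smoothing error is itself bounded by a Gaussian kernel, whose expectation has a Fourier
    representation.\<close>
  also have "\<dots> \<le> expectation (\<lambda>a. exp (- ((x - a) / \<delta>)\<^sup>2 / 2) / 2)"
    using int_k int_ind int_err by (intro integral_mono step_minus_gauss_err) auto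
  also have "\<dots> = \<delta> / (2 * sqrt (2 * pi)) * (\<integral>t. Re (iexp (t * x) * cnj (char M t)) * ?e t \<partial>lborel)"
    by (simp only: integral_divide_zero E_k) simp
  also have "\<dots> \<le> \<delta> / (2 * sqrt (2 * pi)) * (\<integral>t. cmod (char M t) * ?e t \<partial>lborel)"
  proof (intro mult_left_mono integral_mono')
    show "integrable lborel (\<lambda>t. cmod (char M t) * ?e t)"
      using int_e by (rule Bochner_Integration.integrable_bound)
        (auto simp: cmod_char_le_1 mult_left_le_one_le)
    fix t
    have "Re (iexp (t * x) * cnj (char M t)) \<le> cmod (char M t)"
      using complex_Re_le_cmod[of "iexp (t * x) * cnj (char M t)"]
      by (simp add: norm_mult del: of_real_mult)
    then show "Re (iexp (t * x) * cnj (char M t)) * ?e t \<le> cmod (char M t) * ?e t"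
      by (rule mult_right_mono) simp
  qed (use \<delta> in auto)
  also have "\<dots> \<le> \<delta> * (\<integral>t. cmod (char M t) * ?e t \<partial>lborel)"
  proof (rule mult_right_mono)
    have "1 \<le> sqrt (2 * pi)" using pi_gt3 by (simp add: real_le_rsqrt)
    then have "1 \<le> 2 * sqrt (2 * pi)" by linarith
    then have "\<delta> / (2 * sqrt (2 * pi)) \<le> \<delta> / 1" using \<delta> by (intro divide_left_mono) auto
    then show "\<delta> / (2 * sqrt (2 * pi)) \<le> \<delta>" by simp
  qed (intro Bochner_Integration.integral_nonneg mult_nonneg_nonneg, auto)
  finally show "\<bar>cdf M x - 1 / 2
      - (\<integral>t. Im (iexp (t * x) * cnj (char M t)) / t * ?e t \<partial>lborel) / (2 * pi)\<bar>
    \<le> \<delta> * (\<integral>t. cmod (char M t) * ?e t \<partial>lborel)" .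
  show "integrable lborel (\<lambda>t. Im (iexp (t * x) * cnj (char M t)) / t * ?e t)"
    using Fubini_dominated(3)[OF meas1 int_w int_e bound]
    by (simp only: integral_divide_zero integral_mult_left_zero integral_sin_shift)
qed

end

text \<open>Smoothing is applied to both laws; the halves cancel, and
  \<open>integral_sin_gauss\<close> turns the main term into a Fourier integral, so that three
  integrals merge into one. Since the oscillating factor has modulus 1, the bound is free of
  \<open>x\<close>, which is where the uniformity comes from.\<close>

lemma cdf_diff_smoothing:
  fixes P Q :: "real measure"
  assumes "real_distribution P" "real_distribution Q"
    and int: "integrable P (\<lambda>a. a)" "integrable Q (\<lambda>a. a)" and \<delta>: "\<delta> > 0"
    and int_D: "integrable lborel (\<lambda>t. cmod ((char P t - char Q t) / t * exp (- (\<delta> * t)\<^sup>2 / 2)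
      - \<epsilon> * (t * exp (- t\<^sup>2 / 2))))"
  shows "\<bar>cdf P x - cdf Q x - x * exp (- x\<^sup>2 / 2) / sqrt (2 * pi) * \<epsilon>\<bar>
    \<le> \<delta> * (\<integral>t. cmod (char P t) * exp (- (\<delta> * t)\<^sup>2 / 2) \<partial>lborel)
      + \<delta> * (\<integral>t. cmod (char Q t) * exp (- (\<delta> * t)\<^sup>2 / 2) \<partial>lborel)
      + (\<integral>t. cmod ((char P t - char Q t) / t * exp (- (\<delta> * t)\<^sup>2 / 2)
      - \<epsilon> * (t * exp (- t\<^sup>2 / 2))) \<partial>lborel)"
proof -
  let ?e = "\<lambda>t. exp (- (\<delta> * t)\<^sup>2 / 2)"
  let ?D = "\<lambda>t::real. (char P t - char Q t) / t * ?e t - \<epsilon> * (t * exp (- t\<^sup>2 / 2))"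
  let ?S = "\<lambda>M t. Im (iexp (t * x) * cnj (char M t)) / t * ?e t"
  interpret P: real_distribution P by fact
  interpret Q: real_distribution Q by fact
  have int_s: "integrable lborel (\<lambda>t. sin (x * t) * t * exp (- t\<^sup>2 / 2))"
    using gauss_scale(1)[of 1 1]
    by (rule Bochner_Integration.integrable_bound) (auto simp: abs_mult mult_left_le_one_le mult_right_mono)
  note int_P = P.cdf_smoothing(2)[OF int(1) \<delta>, of x] and int_Q = Q.cdf_smoothing(2)[OF int(2) \<delta>, of x]
  have main: "x * exp (- x\<^sup>2 / 2) / sqrt (2 * pi) = (\<integral>t. sin (x * t) * t * exp (- t\<^sup>2 / 2) \<partial>lborel) / (2 * pi)"
    unfolding integral_sin_gauss by (simp add: field_simps)
  have le_2pi: "u / (2 * pi) \<le> v" if "u \<le> v" "0 \<le> u" for u v :: real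
  proof -
    have "u / (2 * pi) \<le> u / 1" using that pi_gt3 by (intro divide_left_mono) auto
    with that show ?thesis by simp
  qed
  have pt: "?S P t - ?S Q t - \<epsilon> * (sin (x * t) * t * exp (- t\<^sup>2 / 2)) = Im (iexp (t * x) * cnj (?D t))" for t
    by (simp add: Im_exp Re_exp algebra_simps diff_divide_distrib)
  have "\<bar>(\<integral>t. ?S P t \<partial>lborel) - (\<integral>t. ?S Q t \<partial>lborel)
        - \<epsilon> * (\<integral>t. sin (x * t) * t * exp (- t\<^sup>2 / 2) \<partial>lborel)\<bar>
      = \<bar>\<integral>t. ?S P t - ?S Q t - \<epsilon> * (sin (x * t) * t * exp (- t\<^sup>2 / 2)) \<partial>lborel\<bar>"
    using int_P int_Q int_s
    by (simp only: integral_mult_right_zero Bochner_Integration.integral_diff integrable_mult_right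
        Bochner_Integration.integrable_diff)
  also have "\<dots> \<le> (\<integral>t. \<bar>Im (iexp (t * x) * cnj (?D t))\<bar> \<partial>lborel)"
    unfolding pt by (rule integral_abs_bound)
  also have "\<dots> \<le> (\<integral>t. cmod (?D t) \<partial>lborel)"
  proof (rule integral_mono'[OF int_D])
    fix t
    have "\<bar>Im (iexp (t * x) * cnj (?D t))\<bar> \<le> cmod (iexp (t * x) * cnj (?D t))"
      by (rule abs_Im_le_cmod)
    then show "\<bar>Im (iexp (t * x) * cnj (?D t))\<bar> \<le> cmod (?D t)"
      by (simp only: norm_mult complex_mod_cnj norm_exp_i_times mult_1_left)
  qed simp
  finally have "\<bar>(\<integral>t. ?S P t \<partial>lborel) - (\<integral>t. ?S Q t \<partial>lborel)
        - \<epsilon> * (\<integral>t. sin (x * t) * t * exp (- t\<^sup>2 / 2) \<partial>lborel)\<bar> \<le> (\<integral>t. cmod (?D t) \<partial>lborel)" (is "?L \<le> ?R") .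
  then have "?L / (2 * pi) \<le> ?R"
    by (rule le_2pi) simp
  then have "\<bar>(\<integral>t. ?S P t \<partial>lborel) / (2 * pi) - (\<integral>t. ?S Q t \<partial>lborel) / (2 * pi)
        - (x * exp (- x\<^sup>2 / 2) / sqrt (2 * pi)) * \<epsilon>\<bar> \<le> ?R"
    unfolding main by (simp add: diff_divide_distrib[symmetric] mult.commute)
  then show ?thesis
    using P.cdf_smoothing(1)[OF int(1) \<delta>, of x] Q.cdf_smoothing(1)[OF int(2) \<delta>, of x]
    by linarith
qed

section \<open>Characteristic functions of the increments\<close>

text \<open>Each of the \<open>k\<close> mixed products in the factorization of the difference has
  total degree \<open>k - 1\<close>, hence is bounded by the power \<open>k - 1\<close> of the
  larger norm. Keeping \<open>E\<close> in place of 1 preserves the decay in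
  \<open>t\<close>.\<close>

lemma norm_power_diff_le:
  fixes x y :: "'a::real_normed_field"
  assumes "norm x ^ (k - 1) \<le> E" "norm y ^ (k - 1) \<le> E"
  shows "norm (x ^ k - y ^ k) \<le> norm (x - y) * (real k * E)"
proof -
  have term_le: "norm (y ^ (k - Suc j) * x ^ j) \<le> E" if "j < k" for j
  proof -
    let ?m = "max (norm x) (norm y)"
    have "norm (y ^ (k - Suc j) * x ^ j) \<le> ?m ^ (k - Suc j) * ?m ^ j"
      unfolding norm_mult norm_power by (intro mult_mono power_mono) (auto simp: le_max_iff_disj)
    also have "\<dots> = ?m ^ (k - 1)" using that by (simp flip: power_add)
    also have "\<dots> \<le> E" using assms by (simp add: max_def)
    finally show ?thesis .
  qed
  have "norm (x ^ k - y ^ k) = norm (x - y) * norm (\<Sum>j<k. y ^ (k - Suc j) * x ^ j)"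
    by (simp add: power_diff_sumr2 norm_mult)
  also have "norm (\<Sum>j<k. y ^ (k - Suc j) * x ^ j) \<le> (\<Sum>j<k. E)"
    by (intro sum_norm_le) (use term_le in auto)
  finally show ?thesis by (simp add: mult_left_mono)
qed

text \<open>
  Characteristic functions of the two increments times \<open>n / (sqrt k * \<sigma>)\<close>, where \<open>g\<close> is that of one
  standardized variable. In \<open>cf_minus\<close> the exponent \<open>n - k\<close> is a truncated subtraction.
\<close>

definition cf_plus :: "(real \<Rightarrow> complex) \<Rightarrow> nat \<Rightarrow> nat \<Rightarrow> real \<Rightarrow> complex" where
  "cf_plus g n k t = g (- sqrt k / (n + k) * t) ^ n * g (n / (sqrt k * (n + k)) * t) ^ k"

definition cf_minus :: "(real \<Rightarrow> complex) \<Rightarrow> nat \<Rightarrow> nat \<Rightarrow> real \<Rightarrow> complex" where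
  "cf_minus g n k t = g (- sqrt k / (real n - real k) * t) ^ (n - k) * g (t / sqrt k) ^ k"

lemma cf_plus_conv:
  assumes "k \<ge> 1" "n \<ge> 1"
  defines "s \<equiv> (\<lambda>t. t / sqrt (real k))" and "\<epsilon> \<equiv> real k / real n"
  shows "cf_plus g n k t = g (- (s t * \<epsilon> / (1 + \<epsilon>))) ^ n * g (s t / (1 + \<epsilon>)) ^ k"
proof -
  have "1 + \<epsilon> = (n + k) / n" using assms by (simp add: add_divide_distrib)
  then have "- (s t * \<epsilon> / (1 + \<epsilon>)) = - (t * (k / sqrt k) / (n + k))"
    using assms by simp
  then have "- sqrt k / (n + k) * t = - (s t * \<epsilon> / (1 + \<epsilon>))"
    by (simp add: real_div_sqrt)
  moreover have "n / (sqrt k * (n + k)) * t = s t / (1 + \<epsilon>)"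
    using assms by (simp add: field_simps)
  ultimately show ?thesis by (simp add: cf_plus_def)
qed

lemma cf_minus_conv:
  assumes "k \<ge> 1" "n > k"
  defines "s \<equiv> (\<lambda>t. t / sqrt (real k))" and "\<epsilon> \<equiv> real k / real n"
  shows "cf_minus g n k t = g (- (s t * \<epsilon> / (1 - \<epsilon>))) ^ (n - k) * g (s t) ^ k"
proof -
  have "- sqrt k / (real n - real k) * t = - (s t * \<epsilon> / (1 - \<epsilon>))"
    using assms by (simp add: field_simps)
  then show ?thesis by (simp add: cf_minus_def s_def)
qed

section \<open>Estimates for fixed sizes \<open>n\<close>, \<open>k\<close> and a fixed frequency
  \<open>t\<close>\<close>

context
  fixes g :: "real \<Rightarrow> complex" and b \<rho> \<beta> :: real
  assumes g0: "g 0 = 1"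
    and le1: "\<And>a. cmod (g a) \<le> 1"
    and lip1_max: "\<And>a a'. cmod (g a - g a') \<le> \<bar>a - a'\<bar> * max \<bar>a\<bar> \<bar>a'\<bar>"
    and lip2_max: "\<And>a a'. cmod (g a - g a' + (a\<^sup>2 - a'\<^sup>2) / 2) \<le> \<bar>a - a'\<bar> * (max \<bar>a\<bar> \<bar>a'\<bar>)\<^sup>2 * \<beta>"
    and decay: "\<And>a j. cmod (g a) ^ j \<le> exp (- (b * real j * a\<^sup>2)) + \<rho> ^ j"
    and b: "b > 0" and \<rho>: "0 < \<rho>" "\<rho> < 1"
begin

text \<open>\<beta> stands for the third absolute moment; abstractly its sign follows from the
  second order bound at the points 1 and 0.\<close>

lemma beta_nonneg: "0 \<le> \<beta>"
  using order_trans[OF norm_ge_zero lip2_max[of 1 0]] by simp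

lemma lip1:
  assumes "\<bar>a\<bar> \<le> c" "\<bar>a'\<bar> \<le> c"
  shows "cmod (g a - g a') \<le> \<bar>a - a'\<bar> * c"
  using assms by (intro order_trans[OF lip1_max] mult_left_mono) auto

lemma lip2:
  assumes "\<bar>a\<bar> \<le> c" "\<bar>a'\<bar> \<le> c"
  shows "cmod (g a - g a' + (a\<^sup>2 - a'\<^sup>2) / 2) \<le> \<bar>a - a'\<bar> * c\<^sup>2 * \<beta>"
  using assms beta_nonneg
  by (intro order_trans[OF lip2_max] mult_right_mono mult_left_mono power_mono) (auto simp: le_max_iff_disj)

lemma g_power_minus_1: "cmod (g a ^ j - 1) \<le> real j * a\<^sup>2"
proof -
  have "cmod (g a ^ j - 1 ^ j) \<le> real j * cmod (g a - 1)"
    by (rule norm_power_diff) (auto simp: le1)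
  also have "cmod (g a - 1) \<le> a\<^sup>2"
    using lip1[of a "\<bar>a\<bar>" 0] by (simp add: g0 power2_eq_square)
  finally show ?thesis by (simp add: mult_left_mono)
qed

text \<open>Up to the factor \<open>1 / (1 + \<epsilon>)\<close>, \<open>s\<close> is the frequency
  seen by a variable of the short block, and \<open>E\<close> will bound the powers of
  \<open>g\<close> there. The condition \<open>2 * k \<le> n\<close> gives
  \<open>\<epsilon> \<le> 1 / 2\<close>, so \<open>1 - \<epsilon>\<close> stays away from 0;
  \<open>2 \<le> k\<close> keeps \<open>k - 1\<close> comparable to \<open>k\<close>.\<close>

context
  fixes n k :: nat and t s \<epsilon> E :: real
  assumes k: "2 \<le> k" "2 * k \<le> n"
  defines "s \<equiv> t / sqrt (real k)" and "\<epsilon> \<equiv> real k / real n"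
    and "E \<equiv> exp (- (b * t\<^sup>2 / 5)) + \<rho> ^ (k - 1)"
begin

lemma eps_bounds: "0 < \<epsilon>" "\<epsilon> \<le> 1 / 2"
  using k by (auto simp: \<epsilon>_def field_simps)

lemma k_mult_s_sq: "real k * s\<^sup>2 = t\<^sup>2"
  using k by (simp add: s_def power_divide)

lemma n_mult_eps: "real n * \<epsilon> = real k"
  using k by (simp add: \<epsilon>_def)

lemma cf_plus_eq: "cf_plus g n k t = g (- (s * \<epsilon> / (1 + \<epsilon>))) ^ n * g (s / (1 + \<epsilon>)) ^ k"
  and cf_minus_eq: "cf_minus g n k t = g (- (s * \<epsilon> / (1 - \<epsilon>))) ^ (n - k) * g s ^ k"
  using cf_plus_conv[of k n g t] cf_minus_conv[of k n g t] k by (auto simp: s_def \<epsilon>_def)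

text \<open>The factor 2/3 is the least value of \<open>1 / (1 + \<epsilon>)\<close> for
  \<open>\<epsilon> \<le> 1 / 2\<close>, so both short-block arguments \<open>s\<close> and
  \<open>s / (1 + \<epsilon>)\<close> qualify.\<close>

lemma power_decay_le:
  assumes "2 / 3 * \<bar>s\<bar> \<le> \<bar>a\<bar>"
  shows "cmod (g a) ^ (k - 1) \<le> E" "cmod (g a) ^ k \<le> E"
proof -
  \<comment> \<open>As \<open>a\<^sup>2 \<ge> 4 / 9 * s\<^sup>2\<close>, the constant 1/5 in
    \<open>E\<close> is admissible once \<open>4 / 9 * (k - 1) \<ge> k / 5\<close>, which holds for
    \<open>k \<ge> 2\<close>.\<close>
  have "t\<^sup>2 / 5 \<le> real (k - 1) * a\<^sup>2"
  proof -
    have "t\<^sup>2 / 5 = real k / 5 * s\<^sup>2" using k_mult_s_sq by simp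
    also have "\<dots> \<le> (real (k - 1) * (4 / 9)) * s\<^sup>2"
      using k by (intro mult_right_mono) (auto simp: of_nat_diff)
    also have "\<dots> = real (k - 1) * (2 / 3 * \<bar>s\<bar>)\<^sup>2" by (simp add: power_mult_distrib power_divide)
    also have "\<dots> \<le> real (k - 1) * \<bar>a\<bar>\<^sup>2"
      using assms by (intro mult_left_mono power_mono) auto
    finally show ?thesis by simp
  qed
  then have "b * (t\<^sup>2 / 5) \<le> b * (real (k - 1) * a\<^sup>2)" using b by (intro mult_left_mono) auto
  then have "exp (- (b * real (k - 1) * a\<^sup>2)) \<le> exp (- (b * t\<^sup>2 / 5))"
    unfolding exp_le_cancel_iff by (simp add: mult.assoc)
  then show 1: "cmod (g a) ^ (k - 1) \<le> E"
    unfolding E_def using decay[of a "k - 1"] by linarith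
  have "cmod (g a) ^ k \<le> cmod (g a) ^ (k - 1)"
    using le1 by (intro power_decreasing) auto
  with 1 show "cmod (g a) ^ k \<le> E" by simp
qed

lemma scaled_s_lower: "2 / 3 * \<bar>s\<bar> \<le> \<bar>s / (1 + \<epsilon>)\<bar>"
proof -
  have "(2 / 3 * (1 + \<epsilon>)) * \<bar>s\<bar> \<le> 1 * \<bar>s\<bar>"
    using eps_bounds by (intro mult_right_mono) auto
  then show ?thesis using eps_bounds by (simp add: field_simps)
qed

lemma scaled_s_diff: "\<bar>s / (1 + \<epsilon>) - s\<bar> \<le> \<epsilon> * \<bar>s\<bar>" "\<bar>s / (1 + \<epsilon>)\<bar> \<le> \<bar>s\<bar>"
proof -
  have "s / (1 + \<epsilon>) - s = - (\<epsilon> * s / (1 + \<epsilon>))" using eps_bounds by (simp add: field_simps)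
  then have "\<bar>s / (1 + \<epsilon>) - s\<bar> = \<epsilon> * \<bar>s\<bar> / (1 + \<epsilon>)" using eps_bounds by (simp add: abs_mult)
  also have "\<dots> \<le> \<epsilon> * \<bar>s\<bar> / 1" using eps_bounds by (intro divide_left_mono) auto
  finally show "\<bar>s / (1 + \<epsilon>) - s\<bar> \<le> \<epsilon> * \<bar>s\<bar>" by simp
  have "\<bar>s / (1 + \<epsilon>)\<bar> = \<bar>s\<bar> / (1 + \<epsilon>)" using eps_bounds by simp
  also have "\<dots> \<le> \<bar>s\<bar> / 1" using eps_bounds by (intro divide_left_mono) auto
  finally show "\<bar>s / (1 + \<epsilon>)\<bar> \<le> \<bar>s\<bar>" by simp
qed

lemma g_scaled_diff: "cmod (g (s / (1 + \<epsilon>)) - g s) \<le> \<epsilon> * s\<^sup>2"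
proof -
  have "cmod (g (s / (1 + \<epsilon>)) - g s) \<le> \<bar>s / (1 + \<epsilon>) - s\<bar> * \<bar>s\<bar>"
    using scaled_s_diff by (intro lip1) auto
  also have "\<dots> \<le> (\<epsilon> * \<bar>s\<bar>) * \<bar>s\<bar>" using scaled_s_diff by (intro mult_right_mono) auto
  finally show ?thesis by (simp add: power2_eq_square mult.assoc)
qed

lemma k_g_scaled_diff: "real k * cmod (g (s / (1 + \<epsilon>)) - g s) \<le> \<epsilon> * t\<^sup>2"
proof -
  have "real k * cmod (g (s / (1 + \<epsilon>)) - g s) \<le> real k * (\<epsilon> * s\<^sup>2)"
    by (intro mult_left_mono g_scaled_diff) auto
  also have "\<dots> = \<epsilon> * t\<^sup>2" by (simp flip: k_mult_s_sq)
  finally show ?thesis .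
qed

text \<open>The arguments in the long block have size at most
  \<open>\<epsilon> * \<bar>s\<bar>\<close>, and
  \<open>n * (\<epsilon> * s)\<^sup>2 = \<epsilon> * t\<^sup>2\<close> because
  \<open>n * \<epsilon> = k\<close> and \<open>k * s\<^sup>2 = t\<^sup>2\<close>.\<close>

lemma large_block_near_1: "cmod (g (- (s * \<epsilon> / (1 + \<epsilon>))) ^ n - 1) \<le> \<epsilon> * t\<^sup>2"
proof -
  have "cmod (g (- (s * \<epsilon> / (1 + \<epsilon>))) ^ n - 1) \<le> real n * (- (s * \<epsilon> / (1 + \<epsilon>)))\<^sup>2"
    by (rule g_power_minus_1)
  also have "\<dots> = real n * ((s / (1 + \<epsilon>))\<^sup>2 * \<epsilon>\<^sup>2)"
    by (simp add: power_mult_distrib power_divide)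
  also have "\<dots> \<le> real n * (s\<^sup>2 * \<epsilon>\<^sup>2)"
    using scaled_s_diff(2) by (intro mult_left_mono mult_right_mono) (auto simp flip: abs_le_square_iff simp del: abs_divide)
  also have "\<dots> = \<epsilon> * ((real n * \<epsilon>) * s\<^sup>2)" by (simp add: power2_eq_square)
  also have "\<dots> = \<epsilon> * t\<^sup>2" by (simp only: n_mult_eps k_mult_s_sq)
  finally show ?thesis .
qed

text \<open>Two changes, both of second order in \<epsilon>. Moving the argument costs \<open>n * (4
  * \<epsilon>\<^sup>2 * \<bar>s\<bar>) * (2 * \<epsilon> * \<bar>s\<bar>) = 8 * \<epsilon>\<^sup>2
  * t\<^sup>2\<close>; dropping \<open>k\<close> of the \<open>n\<close> factors costs \<open>k * (2
  * \<epsilon> * \<bar>s\<bar>)\<^sup>2 = 4 * \<epsilon>\<^sup>2 * t\<^sup>2\<close>.\<close>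

lemma large_block_diff:
  "cmod (g (- (s * \<epsilon> / (1 + \<epsilon>))) ^ n - g (- (s * \<epsilon> / (1 - \<epsilon>))) ^ (n - k)) \<le> 12 * \<epsilon>\<^sup>2 * t\<^sup>2"
proof -
  define u where "u = - (s * \<epsilon> / (1 + \<epsilon>))"
  define v where "v = - (s * \<epsilon> / (1 - \<epsilon>))"
  have v: "\<bar>v\<bar> \<le> 2 * \<epsilon> * \<bar>s\<bar>"
  proof -
    have "\<bar>v\<bar> = \<bar>s\<bar> * \<epsilon> / (1 - \<epsilon>)" using eps_bounds by (simp add: v_def abs_mult)
    also have "\<dots> \<le> \<bar>s\<bar> * \<epsilon> / (1 / 2)" using eps_bounds by (intro divide_left_mono) auto
    finally show ?thesis by (simp add: mult_ac)
  qed
  have u: "\<bar>u\<bar> \<le> 2 * \<epsilon> * \<bar>s\<bar>"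
  proof -
    have "\<bar>u\<bar> = \<bar>s\<bar> * \<epsilon> / (1 + \<epsilon>)" using eps_bounds by (simp add: u_def abs_mult)
    also have "\<dots> \<le> \<bar>s\<bar> * \<epsilon> / (1 / 2)" using eps_bounds by (intro divide_left_mono) auto
    finally show ?thesis by (simp add: mult_ac)
  qed
  have uv: "\<bar>u - v\<bar> \<le> 4 * \<epsilon>\<^sup>2 * \<bar>s\<bar>"
  proof -
    have e1: "1 - \<epsilon>\<^sup>2 = (1 + \<epsilon>) * (1 - \<epsilon>)" by (simp add: power2_eq_square algebra_simps)
    have sq: "\<epsilon>\<^sup>2 \<le> 1 / 2" using eps_bounds power_mono[of \<epsilon> "1 / 2" 2] by (simp add: power_divide)
    have "u - v = 2 * \<epsilon>\<^sup>2 * s / (1 - \<epsilon>\<^sup>2)"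
      using eps_bounds unfolding u_def v_def e1 by (simp add: field_simps power2_eq_square)
    then have "\<bar>u - v\<bar> = 2 * \<epsilon>\<^sup>2 * \<bar>s\<bar> / (1 - \<epsilon>\<^sup>2)" using sq by (simp add: abs_mult)
    also have "\<dots> \<le> 2 * \<epsilon>\<^sup>2 * \<bar>s\<bar> / (1 / 2)" using sq by (intro divide_left_mono) auto
    finally show ?thesis by simp
  qed
  have 1: "cmod (g u ^ n - g v ^ n) \<le> 8 * \<epsilon>\<^sup>2 * t\<^sup>2"
  proof -
    have "cmod (g u ^ n - g v ^ n) \<le> real n * cmod (g u - g v)"
      by (rule norm_power_diff) (auto simp: le1)
    also have "\<dots> \<le> real n * (\<bar>u - v\<bar> * (2 * \<epsilon> * \<bar>s\<bar>))"
      by (intro mult_left_mono lip1 u v) auto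
    also have "\<dots> \<le> real n * ((4 * \<epsilon>\<^sup>2 * \<bar>s\<bar>) * (2 * \<epsilon> * \<bar>s\<bar>))"
      using eps_bounds by (intro mult_left_mono mult_right_mono uv) auto
    also have "\<dots> = 8 * \<epsilon>\<^sup>2 * ((real n * \<epsilon>) * s\<^sup>2)" by (simp add: power2_eq_square)
    also have "\<dots> = 8 * \<epsilon>\<^sup>2 * t\<^sup>2" by (simp only: n_mult_eps k_mult_s_sq)
    finally show ?thesis .
  qed
  have 2: "cmod (g v ^ n - g v ^ (n - k)) \<le> 4 * \<epsilon>\<^sup>2 * t\<^sup>2"
  proof -
    have "g v ^ n - g v ^ (n - k) = g v ^ (n - k) * (g v ^ k - 1)"
      using k by (simp add: algebra_simps flip: power_add)
    then have "cmod (g v ^ n - g v ^ (n - k)) = cmod (g v) ^ (n - k) * cmod (g v ^ k - 1)"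
      by (simp add: norm_mult norm_power)
    also have "\<dots> \<le> 1 * (real k * v\<^sup>2)"
      by (intro mult_mono g_power_minus_1 power_le_one) (auto simp: le1)
    also have "\<dots> \<le> 1 * (real k * (2 * \<epsilon> * \<bar>s\<bar>)\<^sup>2)"
      using power_mono[OF v abs_ge_zero, of 2] by (simp add: mult_left_mono)
    also have "\<dots> = 4 * \<epsilon>\<^sup>2 * t\<^sup>2" by (simp add: power_mult_distrib flip: k_mult_s_sq)
    finally show ?thesis .
  qed
  have "cmod (g u ^ n - g v ^ (n - k)) \<le> cmod (g u ^ n - g v ^ n) + cmod (g v ^ n - g v ^ (n - k))"
    using norm_triangle_ineq[of "g u ^ n - g v ^ n" "g v ^ n - g v ^ (n - k)"] by simp
  with 1 2 show ?thesis unfolding u_def v_def by linarith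
qed

text \<open>The long block is bounded by 1; all the decay comes from the short block.\<close>

lemma cmod_cf_le: "cmod (cf_plus g n k t) \<le> E" "cmod (cf_minus g n k t) \<le> E"
proof -
  have E0: "0 \<le> E" using \<rho> by (simp add: E_def)
  have le: "x * y \<le> E" if "0 \<le> x" "x \<le> 1" "y \<le> E" for x y
  proof -
    have "x * y \<le> x * E" using that by (intro mult_left_mono) auto
    also have "\<dots> \<le> E" using that E0 by (intro mult_left_le_one_le)
    finally show ?thesis .
  qed
  show "cmod (cf_plus g n k t) \<le> E" "cmod (cf_minus g n k t) \<le> E"
    unfolding cf_plus_eq cf_minus_eq norm_mult norm_power
    by (intro le power_decay_le scaled_s_lower power_le_one zero_le_power; simp add: le1)+
qed

text \<open>The first summand contains the main effect, the change of the short-block argument from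
  \<open>s\<close> to \<open>s / (1 + \<epsilon>)\<close>; the second contains only the second order
  change of the long block.\<close>

lemma cf_diff_eq: "cf_plus g n k t - cf_minus g n k t
  = g (- (s * \<epsilon> / (1 + \<epsilon>))) ^ n * (g (s / (1 + \<epsilon>)) ^ k - g s ^ k)
    + g s ^ k * (g (- (s * \<epsilon> / (1 + \<epsilon>))) ^ n - g (- (s * \<epsilon> / (1 - \<epsilon>))) ^ (n - k))"
  unfolding cf_plus_eq cf_minus_eq by (simp add: algebra_simps)

text \<open>A crude majorant for every \<open>t\<close>, used to dominate the quotient by
  \<epsilon>. The first summand of the splitting contributes 1 and the second 12, where one factor
  \<epsilon> is estimated by 1.\<close>

lemma cmod_cf_diff_le: "cmod (cf_plus g n k t - cf_minus g n k t) \<le> 13 * \<epsilon> * t\<^sup>2 * E"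
proof -
  have E0: "0 \<le> E" using \<rho> by (simp add: E_def)
  have "cmod (cf_plus g n k t - cf_minus g n k t)
      \<le> cmod (g (- (s * \<epsilon> / (1 + \<epsilon>)))) ^ n * cmod (g (s / (1 + \<epsilon>)) ^ k - g s ^ k)
        + cmod (g s) ^ k * cmod (g (- (s * \<epsilon> / (1 + \<epsilon>))) ^ n - g (- (s * \<epsilon> / (1 - \<epsilon>))) ^ (n - k))"
    unfolding cf_diff_eq by (rule order_trans[OF norm_triangle_ineq]) (simp add: norm_mult norm_power)
  also have "\<dots> \<le> 1 * (cmod (g (s / (1 + \<epsilon>)) - g s) * (real k * E)) + E * (12 * \<epsilon>\<^sup>2 * t\<^sup>2)"
    using E0 by (intro add_mono mult_mono norm_power_diff_le power_decay_le scaled_s_lower large_block_diff power_le_one)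
      (auto simp: le1)
  also have "\<dots> \<le> \<epsilon> * t\<^sup>2 * E + E * (12 * (\<epsilon> * 1) * t\<^sup>2)"
  proof (intro add_mono mult_left_mono mult_right_mono)
    show "1 * (cmod (g (s / (1 + \<epsilon>)) - g s) * (real k * E)) \<le> \<epsilon> * t\<^sup>2 * E"
      using mult_right_mono[OF k_g_scaled_diff E0] by (simp add: mult_ac)
    show "\<epsilon>\<^sup>2 \<le> \<epsilon> * 1" using eps_bounds by (simp add: power2_eq_square)
  qed (use E0 in auto)
  also have "\<dots> = 13 * \<epsilon> * t\<^sup>2 * E" by simp
  finally show ?thesis .
qed

text \<open>The central limit estimate: \<open>g s\<close> and \<open>exp (- s\<^sup>2 / 2)\<close>
  are both compared with \<open>1 - s\<^sup>2 / 2\<close>, and passing to powers multiplies the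
  error by \<open>k\<close>, where \<open>k * s\<^sup>2 = t\<^sup>2\<close>.\<close>

lemma g_power_k_approx:
  "cmod (g s ^ k - exp (- t\<^sup>2 / 2)) \<le> t\<^sup>2 * (\<bar>s\<bar> * \<beta> + s\<^sup>2)"
proof -
  define y where "y = s\<^sup>2 / 2"
  have y: "0 \<le> y" by (simp add: y_def)
  have exp_y: "\<bar>exp (- y) - (1 - y)\<bar> \<le> y\<^sup>2"
  proof -
    have "1 - y \<le> exp (- y)" using exp_ge_add_one_self[of "- y"] by simp
    moreover have "exp (- y) \<le> 1 - y + y\<^sup>2"
    proof -
      \<comment> \<open>The product equals \<open>1 + y ^ 3\<close>.\<close>
      have "1 \<le> (1 + y) * (1 - y + y\<^sup>2)" using y by (simp add: algebra_simps power2_eq_square)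
      then have "1 / (1 + y) \<le> 1 - y + y\<^sup>2" using y by (simp add: field_simps)
      moreover have "exp (- y) \<le> 1 / (1 + y)"
        using exp_ge_add_one_self[of y] y by (simp add: exp_minus field_simps)
      ultimately show ?thesis by simp
    qed
    ultimately show ?thesis by (simp add: abs_le_iff)
  qed
  have "exp (- t\<^sup>2 / 2) = exp (- y) ^ k"
    using k_mult_s_sq by (simp add: y_def flip: exp_of_nat_mult)
  then have "cmod (g s ^ k - exp (- t\<^sup>2 / 2)) = cmod (g s ^ k - of_real (exp (- y)) ^ k)"
    by simp
  also have "\<dots> \<le> real k * cmod (g s - of_real (exp (- y)))"
    using y by (intro norm_power_diff) (auto simp: le1)
  also have "\<dots> \<le> real k * (\<bar>s\<bar> * s\<^sup>2 * \<beta> + y\<^sup>2)"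
  proof (intro mult_left_mono)
    have "g s - of_real (exp (- y)) = (g s - g 0 + (s\<^sup>2 - 0\<^sup>2) / 2) - of_real (exp (- y) - (1 - y))"
      by (simp add: g0 y_def)
    also have "cmod \<dots> \<le> cmod (g s - g 0 + (s\<^sup>2 - 0\<^sup>2) / 2) + \<bar>exp (- y) - (1 - y)\<bar>"
      by (rule order_trans[OF norm_triangle_ineq4]) (simp only: norm_of_real order_refl)
    also have "\<dots> \<le> \<bar>s\<bar> * s\<^sup>2 * \<beta> + y\<^sup>2"
      using lip2[of s "\<bar>s\<bar>" 0] exp_y by simp
    finally show "cmod (g s - of_real (exp (- y))) \<le> \<bar>s\<bar> * s\<^sup>2 * \<beta> + y\<^sup>2" .
  qed simp
  also have "\<dots> \<le> real k * (\<bar>s\<bar> * s\<^sup>2 * \<beta> + s\<^sup>2 * s\<^sup>2)"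
    using mult_mono[of y "s\<^sup>2" y "s\<^sup>2"] y
    by (intro mult_left_mono add_left_mono) (auto simp: y_def power2_eq_square[of "s\<^sup>2 / 2"])
  also have "\<dots> = (real k * s\<^sup>2) * (\<bar>s\<bar> * \<beta> + s\<^sup>2)" by (simp add: algebra_simps)
  finally show ?thesis by (simp only: k_mult_s_sq)
qed

text \<open>To second order \<open>g a\<close> is \<open>1 - a\<^sup>2 / 2\<close>, so the
  difference is about \<open>(s\<^sup>2 - (s / (1 + \<epsilon>))\<^sup>2) / 2\<close>, which is
  \<open>\<epsilon> * s\<^sup>2\<close> to first order in \<epsilon>. The remainder keeps the factor
  \<open>\<bar>s / (1 + \<epsilon>) - s\<bar> \<le> \<epsilon> * \<bar>s\<bar>\<close>, and
  therefore survives the division by \<epsilon>.\<close>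

lemma g_difference_quotient_approx:
  "cmod (real k * (g (s / (1 + \<epsilon>)) - g s) / \<epsilon> - t\<^sup>2) \<le> t\<^sup>2 * (\<bar>s\<bar> * \<beta> + 2 * \<epsilon>)"
proof -
  define s' where "s' = s / (1 + \<epsilon>)"
  \<comment> \<open>\<open>q\<close> is chosen so that
    \<open>(s\<^sup>2 - s'\<^sup>2) / 2 = \<epsilon> * q * s\<^sup>2\<close>; it tends to 1 as
    \<epsilon> tends to 0.\<close>
  define q where "q = (2 + \<epsilon>) / (2 * (1 + \<epsilon>)\<^sup>2)"
  note \<beta> = beta_nonneg
  have "s\<^sup>2 - s'\<^sup>2 = s\<^sup>2 * (1 - 1 / (1 + \<epsilon>)\<^sup>2)" by (simp add: s'_def power_divide algebra_simps)
  also have "1 - 1 / (1 + \<epsilon>)\<^sup>2 = 2 * \<epsilon> * q"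
    using eps_bounds by (simp add: q_def divide_simps) (simp add: power2_eq_square algebra_simps)
  finally have sq: "s\<^sup>2 - s'\<^sup>2 = 2 * \<epsilon> * q * s\<^sup>2" by simp
  have q: "\<bar>q - 1\<bar> \<le> 2 * \<epsilon>"
  proof -
    have "q - 1 = - (\<epsilon> * (3 + 2 * \<epsilon>) / (2 * (1 + \<epsilon>)\<^sup>2))"
      using eps_bounds by (simp add: q_def divide_simps) (simp add: power2_eq_square algebra_simps)
    then have "\<bar>q - 1\<bar> = \<epsilon> * (3 + 2 * \<epsilon>) / (2 * (1 + \<epsilon>)\<^sup>2)" using eps_bounds by simp
    also have "\<dots> \<le> \<epsilon> * 4 / (2 * 1)"
      using eps_bounds by (intro frac_le mult_left_mono) (auto simp: one_le_power)
    finally show ?thesis by simp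
  qed
  have "real k * (g s' - g s) / \<epsilon> - t\<^sup>2 * q
      = (real k / \<epsilon>) * (g s' - g s + (s'\<^sup>2 - s\<^sup>2) / 2)"
  proof -
    have "complex_of_real (t\<^sup>2 * q) = (real k / \<epsilon>) * complex_of_real ((s\<^sup>2 - s'\<^sup>2) / 2)"
      unfolding of_real_mult[symmetric] of_real_eq_iff sq k_mult_s_sq[symmetric] using eps_bounds by simp
    then show ?thesis by (simp add: algebra_simps diff_divide_distrib)
  qed
  then have "cmod (real k * (g s' - g s) / \<epsilon> - t\<^sup>2 * q)
      = real k / \<epsilon> * cmod (g s' - g s + (s'\<^sup>2 - s\<^sup>2) / 2)"
    using eps_bounds by (simp only: norm_mult norm_of_real) simp
  also have "\<dots> \<le> real k / \<epsilon> * (\<epsilon> * \<bar>s\<bar> * \<bar>s\<bar>\<^sup>2 * \<beta>)"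
  proof (intro mult_left_mono)
    have "cmod (g s' - g s + (s'\<^sup>2 - s\<^sup>2) / 2) \<le> \<bar>s' - s\<bar> * \<bar>s\<bar>\<^sup>2 * \<beta>"
      using scaled_s_diff(2) by (intro lip2) (auto simp: s'_def)
    also have "\<dots> \<le> \<epsilon> * \<bar>s\<bar> * \<bar>s\<bar>\<^sup>2 * \<beta>"
      using scaled_s_diff(1) \<beta> by (intro mult_right_mono) (auto simp: s'_def)
    finally show "cmod (g s' - g s + (s'\<^sup>2 - s\<^sup>2) / 2) \<le> \<epsilon> * \<bar>s\<bar> * \<bar>s\<bar>\<^sup>2 * \<beta>" .
  qed (use eps_bounds in auto)
  also have "\<dots> = (real k * s\<^sup>2) * (\<bar>s\<bar> * \<beta>)" using eps_bounds by simp
  finally have 1: "cmod (real k * (g s' - g s) / \<epsilon> - t\<^sup>2 * q) \<le> t\<^sup>2 * (\<bar>s\<bar> * \<beta>)"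
    by (simp only: k_mult_s_sq)
  have 2: "cmod (of_real (t\<^sup>2 * q) - of_real (t\<^sup>2)) \<le> t\<^sup>2 * (2 * \<epsilon>)"
  proof -
    have "t\<^sup>2 * q - t\<^sup>2 = t\<^sup>2 * (q - 1)" by (simp add: algebra_simps)
    then have "cmod (of_real (t\<^sup>2 * q) - of_real (t\<^sup>2)) = t\<^sup>2 * \<bar>q - 1\<bar>"
      unfolding of_real_diff[symmetric] norm_of_real by (simp add: abs_mult)
    then show ?thesis using q by (simp add: mult_left_mono)
  qed
  have "cmod (real k * (g s' - g s) / \<epsilon> - t\<^sup>2)
      \<le> cmod (real k * (g s' - g s) / \<epsilon> - t\<^sup>2 * q) + cmod (of_real (t\<^sup>2 * q) - of_real (t\<^sup>2))"
    using norm_triangle_ineq[of "real k * (g s' - g s) / \<epsilon> - t\<^sup>2 * q" "of_real (t\<^sup>2 * q) - of_real (t\<^sup>2)"]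
    by simp
  also have "\<dots> \<le> t\<^sup>2 * (\<bar>s\<bar> * \<beta>) + t\<^sup>2 * (2 * \<epsilon>)" by (rule add_mono[OF 1 2])
  finally show ?thesis by (simp add: s'_def algebra_simps)
qed

text \<open>\<open>B\<close> is the average of the mixed powers in the factorization of
  \<open>g (s / (1 + \<epsilon>)) ^ k - g s ^ k\<close>. Three moves lead to
  \<open>exp (- t\<^sup>2 / 2)\<close>, one for each summand of the bound: all factors become
  \<open>g s\<close>, the exponent \<open>k - 1\<close> becomes \<open>k\<close>, and the central
  limit estimate applies.\<close>

lemma power_mean_approx:
  fixes B :: complex
  defines "B \<equiv> (\<Sum>j<k. g s ^ (k - Suc j) * g (s / (1 + \<epsilon>)) ^ j) / k"
  shows "cmod B \<le> 1"
    and "cmod (B - exp (- t\<^sup>2 / 2)) \<le> \<epsilon> * t\<^sup>2 + s\<^sup>2 + t\<^sup>2 * (\<bar>s\<bar> * \<beta> + s\<^sup>2)"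
proof -
  let ?s' = "s / (1 + \<epsilon>)"
  have "cmod (\<Sum>j<k. g s ^ (k - Suc j) * g ?s' ^ j) \<le> (\<Sum>j<k. 1)"
    unfolding norm_mult[symmetric]
    by (intro sum_norm_le) (simp add: norm_mult norm_power le1 mult_le_one power_le_one)
  then show "cmod B \<le> 1" using k by (simp add: B_def norm_divide)
  have "B - g s ^ (k - 1) = (\<Sum>j<k. g s ^ (k - Suc j) * (g ?s' ^ j - g s ^ j)) / k"
  proof -
    have "g s ^ (k - Suc j) * g s ^ j = g s ^ (k - 1)" if "j < k" for j
      using that by (simp flip: power_add)
    then have "(\<Sum>j<k. g s ^ (k - Suc j) * g s ^ j) = k * g s ^ (k - 1)" by simp
    then show ?thesis using k by (simp add: B_def right_diff_distrib sum_subtractf diff_divide_distrib)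
  qed
  then have "cmod (B - g s ^ (k - 1)) = cmod (\<Sum>j<k. g s ^ (k - Suc j) * (g ?s' ^ j - g s ^ j)) / k"
    by (simp add: norm_divide)
  also have "\<dots> \<le> (\<Sum>j<k. \<epsilon> * t\<^sup>2) / k"
  proof (intro divide_right_mono sum_norm_le)
    fix j assume j: "j \<in> {..<k}"
    have "cmod (g s ^ (k - Suc j) * (g ?s' ^ j - g s ^ j)) \<le> 1 * cmod (g ?s' ^ j - g s ^ j)"
      unfolding norm_mult norm_power by (intro mult_right_mono power_le_one) (auto simp: le1)
    also have "\<dots> \<le> real j * cmod (g ?s' - g s)"
      by (simp add: norm_power_diff le1)
    also have "\<dots> \<le> real k * cmod (g ?s' - g s)"
      using j by (intro mult_right_mono) auto
    also have "\<dots> \<le> \<epsilon> * t\<^sup>2" by (rule k_g_scaled_diff)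
    finally show "cmod (g s ^ (k - Suc j) * (g ?s' ^ j - g s ^ j)) \<le> \<epsilon> * t\<^sup>2" .
  qed simp
  also have "\<dots> = \<epsilon> * t\<^sup>2" using k by simp
  finally have 1: "cmod (B - g s ^ (k - 1)) \<le> \<epsilon> * t\<^sup>2" .
  have 2: "cmod (g s ^ (k - 1) - g s ^ k) \<le> s\<^sup>2"
  proof -
    have "g s ^ k = g s ^ (k - 1) * g s" using k by (cases k) auto
    then have "g s ^ (k - 1) - g s ^ k = - (g s ^ (k - 1) * (g s ^ 1 - 1))" by (simp add: algebra_simps)
    then have "cmod (g s ^ (k - 1) - g s ^ k) = cmod (g s) ^ (k - 1) * cmod (g s ^ 1 - 1)"
      by (simp only: norm_minus_cancel norm_mult norm_power)
    also have "\<dots> \<le> 1 * (real 1 * s\<^sup>2)"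
      by (intro mult_mono g_power_minus_1 power_le_one) (auto simp: le1)
    finally show ?thesis by simp
  qed
  have "cmod (B - exp (- t\<^sup>2 / 2)) \<le> cmod (B - g s ^ (k - 1)) + cmod (g s ^ (k - 1) - g s ^ k)
      + cmod (g s ^ k - exp (- t\<^sup>2 / 2))"
    using norm_triangle_ineq[of "B - g s ^ (k - 1)" "g s ^ (k - 1) - g s ^ k"]
      norm_triangle_ineq[of "B - g s ^ k" "g s ^ k - exp (- t\<^sup>2 / 2)"] by simp
  with 1 2 g_power_k_approx show "cmod (B - exp (- t\<^sup>2 / 2)) \<le> \<epsilon> * t\<^sup>2 + s\<^sup>2 + t\<^sup>2 * (\<bar>s\<bar> * \<beta> + s\<^sup>2)"
    by linarith
qed

text \<open>The quotient is \<open>U * A * B + R\<close> with \<open>U\<close> near 1,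
  \<open>A\<close> near \<open>t\<^sup>2\<close>, \<open>B\<close> near the Gaussian and
  \<open>R\<close> of order \<epsilon>; one factor is replaced at a time. For fixed \<open>t\<close>
  the whole bound vanishes as \<open>s\<close> and \<epsilon> tend to 0.\<close>

lemma cf_diff_approx:
  "cmod ((cf_plus g n k t - cf_minus g n k t) / \<epsilon> - t\<^sup>2 * exp (- t\<^sup>2 / 2))
    \<le> t\<^sup>2 * (\<bar>s\<bar> * \<beta> + 2 * \<epsilon>) + t\<^sup>2 * (2 * \<epsilon> * t\<^sup>2 + s\<^sup>2 + t\<^sup>2 * (\<bar>s\<bar> * \<beta> + s\<^sup>2)) + 12 * \<epsilon> * t\<^sup>2"
proof -
  define B where "B = (\<Sum>j<k. g s ^ (k - Suc j) * g (s / (1 + \<epsilon>)) ^ j) / k"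
  define A where "A = real k * (g (s / (1 + \<epsilon>)) - g s) / \<epsilon>"
  define U where "U = g (- (s * \<epsilon> / (1 + \<epsilon>))) ^ n"
  define R where "R = g s ^ k * (U - g (- (s * \<epsilon> / (1 - \<epsilon>))) ^ (n - k)) / \<epsilon>"
  define e where "e = complex_of_real (exp (- t\<^sup>2 / 2))"
  note B = power_mean_approx[folded B_def e_def]
  note A = g_difference_quotient_approx[folded A_def]
  have U: "cmod U \<le> 1" "cmod (U - 1) \<le> \<epsilon> * t\<^sup>2"
    using large_block_near_1 by (auto simp: U_def norm_power le1 power_le_one)
  have R: "cmod R \<le> 12 * \<epsilon> * t\<^sup>2"
  proof -
    have "cmod R = cmod (g s) ^ k * cmod (U - g (- (s * \<epsilon> / (1 - \<epsilon>))) ^ (n - k)) / \<epsilon>"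
      using eps_bounds by (simp add: R_def norm_divide norm_mult norm_power)
    also have "\<dots> \<le> 1 * (12 * \<epsilon>\<^sup>2 * t\<^sup>2) / \<epsilon>"
      using eps_bounds unfolding U_def
      by (intro divide_right_mono mult_mono power_le_one large_block_diff) (auto simp: le1)
    also have "\<dots> = 12 * \<epsilon> * t\<^sup>2" using eps_bounds by (simp add: power2_eq_square)
    finally show ?thesis .
  qed
  have "g (s / (1 + \<epsilon>)) ^ k - g s ^ k = \<epsilon> * (A * B)"
    using eps_bounds k by (simp add: A_def B_def power_diff_sumr2)
  then have "(cf_plus g n k t - cf_minus g n k t) / \<epsilon> = U * A * B + R"
    unfolding cf_diff_eq using eps_bounds by (simp add: U_def R_def add_divide_distrib)
  then have "(cf_plus g n k t - cf_minus g n k t) / \<epsilon> - t\<^sup>2 * e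
      = (A - t\<^sup>2) * (U * B) + (t\<^sup>2 * ((U - 1) * B) + t\<^sup>2 * (B - e)) + R"
    by (simp add: algebra_simps)
  also have "cmod \<dots> \<le> cmod (A - t\<^sup>2) * (cmod U * cmod B)
      + (t\<^sup>2 * (cmod (U - 1) * cmod B) + t\<^sup>2 * cmod (B - e)) + cmod R"
    by (intro norm_triangle_mono order_refl) (simp_all add: norm_mult norm_power)
  also have "\<dots> \<le> t\<^sup>2 * (\<bar>s\<bar> * \<beta> + 2 * \<epsilon>) * (1 * 1)
      + (t\<^sup>2 * (\<epsilon> * t\<^sup>2 * 1) + t\<^sup>2 * (\<epsilon> * t\<^sup>2 + s\<^sup>2 + t\<^sup>2 * (\<bar>s\<bar> * \<beta> + s\<^sup>2))) + 12 * \<epsilon> * t\<^sup>2"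
    using eps_bounds order_trans[OF norm_ge_zero A]
    by (intro add_mono mult_mono mult_left_mono A B U R) auto
  finally show ?thesis by (simp add: e_def algebra_simps)
qed

end

section \<open>Limits along the sequence of block lengths\<close>

context
  fixes k_seq :: "nat \<Rightarrow> nat"
  assumes g_meas [measurable]: "g \<in> borel_measurable borel"
    and k_seq_top: "filterlim k_seq at_top sequentially"
    and ratio: "(\<lambda>n. real (k_seq n) / real n) \<longlonglongrightarrow> 0"
    and tail: "(\<lambda>n. (real n)\<^sup>2 * \<rho> ^ (k_seq n - 1)) \<longlonglongrightarrow> 0"
begin

lemma eventually_small_ratio: "eventually (\<lambda>n. 2 \<le> k_seq n \<and> 2 * k_seq n \<le> n) sequentially"
proof -
  have "eventually (\<lambda>n. 2 \<le> k_seq n) sequentially"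
    using k_seq_top by (simp add: filterlim_at_top)
  moreover have "eventually (\<lambda>n. real (k_seq n) / real n < 1 / 2) sequentially"
    using order_tendstoD(2)[OF ratio, of "1 / 2"] by simp
  moreover have "eventually (\<lambda>n::nat. 0 < n) sequentially" by (rule eventually_gt_at_top)
  ultimately show ?thesis by eventually_elim (auto simp: field_simps)
qed

lemma cf_diff_lim:
  "(\<lambda>n. (cf_plus g n (k_seq n) t - cf_minus g n (k_seq n) t) / of_real (real (k_seq n) / real n))
    \<longlonglongrightarrow> of_real (t\<^sup>2 * exp (- t\<^sup>2 / 2))"
proof (rule LIM_zero_cancel, rule Lim_null_comparison)
  let ?s = "\<lambda>n. t / sqrt (real (k_seq n))" and ?\<epsilon> = "\<lambda>n. real (k_seq n) / real n"
  let ?B = "\<lambda>s \<epsilon>. t\<^sup>2 * (\<bar>s\<bar> * \<beta> + 2 * \<epsilon>) + t\<^sup>2 * (2 * \<epsilon> * t\<^sup>2 + s\<^sup>2 + t\<^sup>2 * (\<bar>s\<bar> * \<beta> + s\<^sup>2)) + 12 * \<epsilon> * t\<^sup>2"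
  show "eventually (\<lambda>n. norm ((cf_plus g n (k_seq n) t - cf_minus g n (k_seq n) t) / of_real (?\<epsilon> n)
      - of_real (t\<^sup>2 * exp (- t\<^sup>2 / 2))) \<le> ?B (?s n) (?\<epsilon> n)) sequentially"
    using eventually_small_ratio by eventually_elim (use cf_diff_approx in simp)
  have s: "?s \<longlonglongrightarrow> 0"
    by (intro real_tendsto_divide_at_top[OF tendsto_const] filterlim_compose[OF sqrt_at_top]
        filterlim_compose[OF filterlim_real_sequentially k_seq_top])
  have "(\<lambda>n. ?B (?s n) (?\<epsilon> n)) \<longlonglongrightarrow> ?B 0 0"
    by (intro tendsto_intros s ratio)
  then show "(\<lambda>n. ?B (?s n) (?\<epsilon> n)) \<longlonglongrightarrow> 0" by simp
qed

text \<open>These are the smoothing errors for \<open>\<delta> = 1 / n\<close> relative to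
  \<open>k / n\<close>; the prefactors leave \<open>1 / k\<close>. The integral stays bounded, since
  the Gaussian part has at most the fixed mass \<open>C\<close> and the geometric part gives a
  multiple of \<open>\<rho> ^ (k - 1) * n\<close>.\<close>

lemma cf_mass_lim:
  assumes [measurable]: "\<And>n. h n \<in> borel_measurable borel"
    and h: "eventually (\<lambda>n. \<forall>t. cmod (h n t) \<le> exp (- (b * t\<^sup>2 / 5)) + \<rho> ^ (k_seq n - 1)) sequentially"
  shows "(\<lambda>n. 1 / real n * (\<integral>t. cmod (h n t) * exp (- (1 / real n * t)\<^sup>2 / 2) \<partial>lborel) / (real (k_seq n) / real n)) \<longlonglongrightarrow> 0"
proof (rule Lim_null_comparison)
  define C where "C = (\<integral>t. exp (- (b * t\<^sup>2 / 5)) \<partial>lborel)"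
  define I where "I = (\<integral>t. \<bar>t\<bar> ^ 0 * exp (- t\<^sup>2 / 2) \<partial>(lborel :: real measure))"
  let ?b = "\<lambda>n. (C + ((real n)\<^sup>2 * \<rho> ^ (k_seq n - 1)) * I / real n) / real (k_seq n)"
  have int_C: "integrable lborel (\<lambda>t. exp (- (b * t\<^sup>2 / 5)))"
    using integrable_abs_power_gauss[of "b / 5" 0] b by simp
  have "?b \<longlonglongrightarrow> 0"
  proof (rule real_tendsto_divide_at_top)
    show "(\<lambda>n. C + ((real n)\<^sup>2 * \<rho> ^ (k_seq n - 1)) * I / real n) \<longlonglongrightarrow> C + 0"
      by (intro tendsto_add tendsto_const real_tendsto_divide_at_top[OF tendsto_mult_left_zero[OF tail]]
          filterlim_real_sequentially)
    show "filterlim (\<lambda>n. real (k_seq n)) at_top sequentially"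
      by (rule filterlim_compose[OF filterlim_real_sequentially k_seq_top])
  qed
  then show "?b \<longlonglongrightarrow> 0" .
  show "eventually (\<lambda>n. norm (1 / real n * (\<integral>t. cmod (h n t) * exp (- (1 / real n * t)\<^sup>2 / 2) \<partial>lborel) / (real (k_seq n) / real n)) \<le> ?b n) sequentially"
    using h eventually_small_ratio
  proof eventually_elim
    case (elim n)
    let ?e = "\<lambda>t. exp (- (1 / real n * t)\<^sup>2 / 2)"
    have n: "0 < n" "0 < k_seq n" using elim by auto
    have int_e: "integrable lborel ?e" and I_e: "(\<integral>t. ?e t \<partial>lborel) = I * real n"
      using gauss_scale[of "1 / real n" 0] n by (simp_all add: I_def)
    have "(\<integral>t. cmod (h n t) * ?e t \<partial>lborel)
        \<le> (\<integral>t. exp (- (b * t\<^sup>2 / 5)) + \<rho> ^ (k_seq n - 1) * ?e t \<partial>lborel)"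
    proof (rule integral_mono')
      show "integrable lborel (\<lambda>t. exp (- (b * t\<^sup>2 / 5)) + \<rho> ^ (k_seq n - 1) * ?e t)"
        using int_e int_C by simp
      fix t
      have "cmod (h n t) * ?e t \<le> (exp (- (b * t\<^sup>2 / 5)) + \<rho> ^ (k_seq n - 1)) * ?e t"
        using elim by (intro mult_right_mono) auto
      also have "\<dots> = exp (- (b * t\<^sup>2 / 5)) * ?e t + \<rho> ^ (k_seq n - 1) * ?e t"
        by (rule distrib_right)
      also have "\<dots> \<le> exp (- (b * t\<^sup>2 / 5)) * 1 + \<rho> ^ (k_seq n - 1) * ?e t"
        by (intro add_right_mono mult_left_mono) auto
      finally show "cmod (h n t) * ?e t \<le> exp (- (b * t\<^sup>2 / 5)) + \<rho> ^ (k_seq n - 1) * ?e t" by simp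
      show "0 \<le> exp (- (b * t\<^sup>2 / 5)) + \<rho> ^ (k_seq n - 1) * ?e t" using \<rho> by simp
    qed
    also have "\<dots> = C + ((real n)\<^sup>2 * \<rho> ^ (k_seq n - 1)) * I / real n"
      using int_e int_C I_e n by (simp add: C_def power2_eq_square)
    finally have le: "(\<integral>t. cmod (h n t) * ?e t \<partial>lborel) \<le> C + ((real n)\<^sup>2 * \<rho> ^ (k_seq n - 1)) * I / real n" .
    have "0 \<le> (\<integral>t. cmod (h n t) * ?e t \<partial>lborel)" by (intro Bochner_Integration.integral_nonneg) simp
    moreover have "1 / real n * (\<integral>t. cmod (h n t) * ?e t \<partial>lborel) / (real (k_seq n) / real n)
        = (\<integral>t. cmod (h n t) * ?e t \<partial>lborel) / real (k_seq n)"
      using n by simp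
    ultimately show ?case using divide_right_mono[OF le, of "real (k_seq n)"] n by simp
  qed
qed

lemma cf_measurable [measurable]:
  "cf_plus g n k \<in> borel_measurable borel" "cf_minus g n k \<in> borel_measurable borel"
  unfolding cf_plus_def[abs_def] cf_minus_def[abs_def] by measurable

lemma cf_plus_mass_lim:
  "(\<lambda>n. 1 / real n * (\<integral>t. cmod (cf_plus g n (k_seq n) t) * exp (- (1 / real n * t)\<^sup>2 / 2) \<partial>lborel) / (real (k_seq n) / real n)) \<longlonglongrightarrow> 0"
  and cf_minus_mass_lim:
  "(\<lambda>n. 1 / real n * (\<integral>t. cmod (cf_minus g n (k_seq n) t) * exp (- (1 / real n * t)\<^sup>2 / 2) \<partial>lborel) / (real (k_seq n) / real n)) \<longlonglongrightarrow> 0"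
proof -
  have p: "eventually (\<lambda>n. \<forall>t. cmod (cf_plus g n (k_seq n) t) \<le> exp (- (b * t\<^sup>2 / 5)) + \<rho> ^ (k_seq n - 1)) sequentially"
    and m: "eventually (\<lambda>n. \<forall>t. cmod (cf_minus g n (k_seq n) t) \<le> exp (- (b * t\<^sup>2 / 5)) + \<rho> ^ (k_seq n - 1)) sequentially"
    using cmod_cf_le by (auto intro: eventually_mono[OF eventually_small_ratio])
  show "(\<lambda>n. 1 / real n * (\<integral>t. cmod (cf_plus g n (k_seq n) t) * exp (- (1 / real n * t)\<^sup>2 / 2) \<partial>lborel) / (real (k_seq n) / real n)) \<longlonglongrightarrow> 0"
    by (rule cf_mass_lim[OF cf_measurable(1) p])
  show "(\<lambda>n. 1 / real n * (\<integral>t. cmod (cf_minus g n (k_seq n) t) * exp (- (1 / real n * t)\<^sup>2 / 2) \<partial>lborel) / (real (k_seq n) / real n)) \<longlonglongrightarrow> 0"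
    by (rule cf_mass_lim[OF cf_measurable(2) m])
qed

text \<open>Convergence of the integrals by domination: after division by \<epsilon> the integrand
  tends to 0 for \<open>t \<noteq> 0\<close> and is at most \<open>w + r n\<close>, where
  \<open>w\<close> is fixed but \<open>r n\<close> is not.\<close>

lemma cf_diff_L1:
  defines "G \<equiv> (\<lambda>n t. cmod ((cf_plus g n (k_seq n) t - cf_minus g n (k_seq n) t) / of_real t * of_real (exp (- (1 / real n * t)\<^sup>2 / 2))
      - of_real ((real (k_seq n) / real n) * (t * exp (- t\<^sup>2 / 2)))))"
  shows "eventually (\<lambda>n. integrable lborel (G n)) sequentially"
    and "(\<lambda>n. (\<integral>t. G n t \<partial>lborel) / (real (k_seq n) / real n)) \<longlonglongrightarrow> 0"
proof -
  define \<epsilon> where "\<epsilon> n = real (k_seq n) / real n" for n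
  define e where "e n t = exp (- (1 / real n * t)\<^sup>2 / 2)" for n and t :: real
  \<comment> \<open>\<open>w\<close> and \<open>r n\<close> carry the Gaussian and the geometric
    part of the crude bound; division by \<open>t\<close> turns \<open>t\<^sup>2\<close> into
    \<open>\<bar>t\<bar>\<close>. The second summand of \<open>w\<close> comes from the main
    term.\<close>
  define w where "w t = 13 * (\<bar>t\<bar> * exp (- (b * t\<^sup>2 / 5))) + \<bar>t\<bar> * exp (- t\<^sup>2 / 2)" for t
  define r where "r n t = 13 * \<rho> ^ (k_seq n - 1) * (\<bar>t\<bar> * e n t)" for n t
  let ?good = "\<lambda>n. 2 \<le> k_seq n \<and> 2 * k_seq n \<le> n"
  have [measurable]: "e n \<in> borel_measurable borel" "w \<in> borel_measurable borel" "r n \<in> borel_measurable borel"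
    "G n \<in> borel_measurable borel" for n
    unfolding e_def[abs_def] w_def[abs_def] r_def[abs_def] G_def by measurable
  have e: "0 \<le> e n t" "e n t \<le> 1" for n t by (auto simp: e_def)
  have eps_bounds: "0 < \<epsilon> n" if "?good n" for n using that by (auto simp: \<epsilon>_def)
  have w0: "0 \<le> w t" for t by (simp add: w_def)
  have r0: "0 \<le> r n t" for n t using \<rho> by (simp add: r_def e)
  have int_w: "integrable lborel w"
    unfolding w_def[abs_def]
    using integrable_abs_power_gauss[of "b / 5" 1] integrable_abs_power_gauss[of "1 / 2" 1] b by simp
  \<comment> \<open>A damping factor of width of order \<open>n\<close> has first absolute moment of
    order \<open>n\<^sup>2\<close>; this is the power that \<open>tail\<close> has to beat.\<close>
  have int_r: "integrable lborel (r n)" and I_r: "(\<integral>t. r n t \<partial>lborel)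
      = 13 * ((real n)\<^sup>2 * \<rho> ^ (k_seq n - 1)) * (\<integral>t. \<bar>t\<bar> ^ 1 * exp (- t\<^sup>2 / 2) \<partial>(lborel :: real measure))"
    if "?good n" for n
    using gauss_scale[of "1 / real n" 1] that
    unfolding r_def[abs_def] e_def by (simp_all add: power2_eq_square)
  \<comment> \<open>At \<open>t = 0\<close> the quotient by \<open>t\<close> is 0 by convention, so
    \<open>G n 0 = 0\<close>.\<close>
  have G_le: "G n t / \<epsilon> n \<le> w t + r n t" if "?good n" for n t
  proof (cases "t = 0")
    case False
    have "G n t \<le> cmod (cf_plus g n (k_seq n) t - cf_minus g n (k_seq n) t) / \<bar>t\<bar> * e n t + \<epsilon> n * (\<bar>t\<bar> * exp (- t\<^sup>2 / 2))"
      unfolding G_def e_def \<epsilon>_def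
      by (rule order_trans[OF norm_triangle_ineq4])
         (simp only: norm_mult norm_divide norm_of_real, simp add: abs_mult)
    also have "\<dots> \<le> 13 * \<epsilon> n * t\<^sup>2 * (exp (- (b * t\<^sup>2 / 5)) + \<rho> ^ (k_seq n - 1)) / \<bar>t\<bar> * e n t + \<epsilon> n * (\<bar>t\<bar> * exp (- t\<^sup>2 / 2))"
      using cmod_cf_diff_le[of "k_seq n" n t] that e unfolding \<epsilon>_def
      by (intro add_right_mono mult_right_mono divide_right_mono) auto
    also have "\<dots> = \<epsilon> n * (13 * \<bar>t\<bar> * exp (- (b * t\<^sup>2 / 5)) * e n t + r n t + \<bar>t\<bar> * exp (- t\<^sup>2 / 2))"
    proof -
      have *: "13 * \<epsilon> n * t\<^sup>2 * x / \<bar>t\<bar> = 13 * \<epsilon> n * \<bar>t\<bar> * x" for x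
        using False by (cases "t \<ge> 0") (auto simp: power2_eq_square)
      show ?thesis unfolding * by (simp add: r_def algebra_simps)
    qed
    also have "\<dots> \<le> \<epsilon> n * (13 * \<bar>t\<bar> * exp (- (b * t\<^sup>2 / 5)) * 1 + r n t + \<bar>t\<bar> * exp (- t\<^sup>2 / 2))"
      using eps_bounds[OF that] e by (intro mult_left_mono add_right_mono) auto
    finally have "G n t \<le> \<epsilon> n * (w t + r n t)" by (simp add: w_def algebra_simps)
    then show ?thesis using eps_bounds[OF that] by (simp add: field_simps)
  qed (use w0 r0 in \<open>simp add: G_def\<close>)
  have int_G: "integrable lborel (G n)" if "?good n" for n
  proof (rule Bochner_Integration.integrable_bound)
    show "integrable lborel (\<lambda>t. \<epsilon> n * (w t + r n t))" using int_w int_r[OF that] by simp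
    have "norm (G n t) \<le> norm (\<epsilon> n * (w t + r n t))" for t
      using G_le[OF that, of t] eps_bounds[OF that] w0[of t] r0[of n t] by (simp add: field_simps) (simp add: G_def)
    then show "AE t in lborel. norm (G n t) \<le> norm (\<epsilon> n * (w t + r n t))" by simp
  qed simp
  show "eventually (\<lambda>n. integrable lborel (G n)) sequentially"
    using eventually_small_ratio by eventually_elim (rule int_G)
  \<comment> \<open>Subtracting \<open>r n\<close>, whose integral tends to 0, leaves a sequence dominated by the fixed \<open>w\<close>.\<close>
  define Q where "Q n t = (if ?good n then max 0 (G n t / \<epsilon> n - r n t) else 0)" for n t
  have [measurable]: "Q n \<in> borel_measurable borel" for n unfolding Q_def[abs_def] by measurable
  \<comment> \<open>\<open>Q n\<close> is 0 for the finitely many \<open>n\<close> that violate the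
    size conditions, so \<open>w\<close> is a majorant for every \<open>n\<close>, as dominated
    convergence demands.\<close>
  have Q_le: "Q n t \<le> w t" for n t using G_le[of n t] w0[of t] by (auto simp: Q_def)
  have Q0: "0 \<le> Q n t" for n t by (simp add: Q_def)
  have G_lim: "(\<lambda>n. G n t / \<epsilon> n) \<longlonglongrightarrow> 0" if t: "t \<noteq> 0" for t
  proof -
    let ?D = "\<lambda>n. (cf_plus g n (k_seq n) t - cf_minus g n (k_seq n) t) / of_real (\<epsilon> n)"
    have "(\<lambda>n. e n t) \<longlonglongrightarrow> exp (- (0 * t)\<^sup>2 / 2)"
      unfolding e_def by (intro tendsto_intros lim_1_over_n) auto
    then have e_lim: "(\<lambda>n. e n t) \<longlonglongrightarrow> 1" by simp
    have "(\<lambda>n. ?D n / of_real t * of_real (e n t) - of_real (t * exp (- t\<^sup>2 / 2)))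
        \<longlonglongrightarrow> of_real (t\<^sup>2 * exp (- t\<^sup>2 / 2)) / of_real t * of_real 1 - of_real (t * exp (- t\<^sup>2 / 2))"
      using t unfolding \<epsilon>_def by (intro tendsto_intros cf_diff_lim e_lim) auto
    then have "(\<lambda>n. cmod (?D n / of_real t * of_real (e n t) - of_real (t * exp (- t\<^sup>2 / 2)))) \<longlonglongrightarrow> 0"
      using t by (intro tendsto_norm_zero) (simp add: power2_eq_square)
    moreover have "eventually (\<lambda>n. cmod (?D n / of_real t * of_real (e n t) - of_real (t * exp (- t\<^sup>2 / 2)))
        = G n t / \<epsilon> n) sequentially"
      using eventually_small_ratio
    proof eventually_elim
      case (elim n)
      have "of_real (\<epsilon> n) * (?D n / of_real t * of_real (e n t) - of_real (t * exp (- t\<^sup>2 / 2)))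
          = (cf_plus g n (k_seq n) t - cf_minus g n (k_seq n) t) / of_real t * of_real (e n t) - of_real (\<epsilon> n * (t * exp (- t\<^sup>2 / 2)))"
      proof -
        have "E * (z / E / u * x - y) = z / u * x - E * y" if "E \<noteq> 0" for E z u x y :: complex
          using that by (simp add: right_diff_distrib)
        from this[of "of_real (\<epsilon> n)"] show ?thesis using eps_bounds[OF elim] by (simp only: of_real_mult) simp
      qed
      then have "G n t = cmod (of_real (\<epsilon> n) * (?D n / of_real t * of_real (e n t) - of_real (t * exp (- t\<^sup>2 / 2))))"
        by (simp only: G_def e_def \<epsilon>_def)
      then show ?case using eps_bounds[OF elim] by (simp only: norm_mult norm_of_real) simp
    qed
    ultimately show ?thesis by (rule Lim_transform_eventually)
  qed
  have Q_lim: "(\<lambda>n. \<integral>t. Q n t \<partial>lborel) \<longlonglongrightarrow> (\<integral>t. 0 \<partial>(lborel :: real measure))"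
  proof (rule integral_dominated_convergence[where w = w])
    show "AE t in lborel. (\<lambda>n. Q n t) \<longlonglongrightarrow> 0"
      using AE_lborel_singleton[of "0::real"]
    proof eventually_elim
      case (elim t)
      show ?case
      proof (rule Lim_null_comparison[OF _ G_lim[OF elim]])
        show "eventually (\<lambda>n. norm (Q n t) \<le> G n t / \<epsilon> n) sequentially"
          using eventually_small_ratio
        proof eventually_elim
          case (elim n)
          then show ?case using eps_bounds[OF elim] r0[of n t] by (auto simp: Q_def G_def max_def)
        qed
      qed
    qed
    show "AE t in lborel. norm (Q n t) \<le> w t" for n using Q0 Q_le by simp
  qed (use int_w in auto)
  let ?J = "13 * (\<integral>t. \<bar>t\<bar> ^ 1 * exp (- t\<^sup>2 / 2) \<partial>(lborel :: real measure))"
  have lim: "(\<lambda>n. (\<integral>t. Q n t \<partial>lborel) + ((real n)\<^sup>2 * \<rho> ^ (k_seq n - 1)) * ?J) \<longlonglongrightarrow> 0 + 0 * ?J"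
    using Q_lim by (intro tendsto_intros tail) simp
  show "(\<lambda>n. (\<integral>t. G n t \<partial>lborel) / (real (k_seq n) / real n)) \<longlonglongrightarrow> 0"
  proof (rule Lim_null_comparison)
    show "(\<lambda>n. (\<integral>t. Q n t \<partial>lborel) + ((real n)\<^sup>2 * \<rho> ^ (k_seq n - 1)) * ?J) \<longlonglongrightarrow> 0"
      using lim by simp
    show "eventually (\<lambda>n. norm ((\<integral>t. G n t \<partial>lborel) / (real (k_seq n) / real n))
        \<le> (\<integral>t. Q n t \<partial>lborel) + ((real n)\<^sup>2 * \<rho> ^ (k_seq n - 1)) * ?J) sequentially"
      using eventually_small_ratio
    proof eventually_elim
      case (elim n)
      have int_Q: "integrable lborel (Q n)"
        by (rule Bochner_Integration.integrable_bound[OF int_w]) (use Q0 Q_le w0 in auto)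
      have "(\<integral>t. G n t / \<epsilon> n \<partial>lborel) \<le> (\<integral>t. Q n t + r n t \<partial>lborel)"
        using int_G[OF elim] int_Q int_r[OF elim] elim
        by (intro integral_mono) (auto simp: Q_def)
      also have "\<dots> = (\<integral>t. Q n t \<partial>lborel) + (\<integral>t. r n t \<partial>lborel)"
        using int_Q int_r[OF elim] by simp
      finally have "(\<integral>t. G n t \<partial>lborel) / \<epsilon> n \<le> (\<integral>t. Q n t \<partial>lborel) + ((real n)\<^sup>2 * \<rho> ^ (k_seq n - 1)) * ?J"
        unfolding I_r[OF elim] by simp
      moreover have "0 \<le> (\<integral>t. G n t \<partial>lborel) / \<epsilon> n"
        using eps_bounds[OF elim] by (intro divide_nonneg_nonneg Bochner_Integration.integral_nonneg) (auto simp: G_def)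
      ultimately show ?case by (simp add: \<epsilon>_def)
    qed
  qed
qed

end

end

section \<open>Increments of the sample mean\<close>

lemma sum_two_blocks:
  fixes v :: "nat \<Rightarrow> real"
  shows "(\<Sum>i=1..n+p. (if i \<le> n then a else b) * v i)
    = a * (\<Sum>i=1..n. v i) + b * ((\<Sum>i=1..n+p. v i) - (\<Sum>i=1..n. v i))"
proof -
  have "(\<Sum>i=1..n+p. (if i \<le> n then a else b) * v i)
      = (\<Sum>i=1..n. (if i \<le> n then a else b) * v i) + (\<Sum>i=n+1..n+p. (if i \<le> n then a else b) * v i)"
    by (rule sum.ub_add_nat) simp
  also have "\<dots> = (\<Sum>i=1..n. a * v i) + (\<Sum>i=n+1..n+p. b * v i)"
    by (intro arg_cong2[where f = "(+)"] sum.cong) auto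
  also have "\<dots> = a * (\<Sum>i=1..n. v i) + b * (\<Sum>i=n+1..n+p. v i)"
    by (simp add: sum_distrib_left)
  finally show ?thesis using sum.ub_add_nat[of 1 n v p] by simp
qed

lemma prod_two_blocks:
  fixes h :: "real \<Rightarrow> complex"
  shows "(\<Prod>i=1..n+p. h ((if i \<le> n then a else b) * t)) = h (a * t) ^ n * h (b * t) ^ p"
proof -
  have "(\<Prod>i=1..n+p. h ((if i \<le> n then a else b) * t))
      = (\<Prod>i=1..n. h ((if i \<le> n then a else b) * t)) * (\<Prod>i=n+1..n+p. h ((if i \<le> n then a else b) * t))"
    by (rule prod.ub_add_nat) simp
  also have "\<dots> = (\<Prod>i=1..n. h (a * t)) * (\<Prod>i=n+1..n+p. h (b * t))"
    by (intro arg_cong2[where f = "(*)"] prod.cong) auto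
  finally show ?thesis by simp
qed

lemma char_distr_mult:
  assumes [measurable]: "Y \<in> borel_measurable M"
  shows "char (distr M borel (\<lambda>\<omega>. c * Y \<omega>)) t = char (distr M borel Y) (c * t)"
  by (simp add: char_def integral_distr mult_ac)

lemma (in prob_space) char_two_blocks:
  fixes V :: "nat \<Rightarrow> 'a \<Rightarrow> real"
  assumes indep: "indep_vars (\<lambda>_. borel) V {1..}"
    and ident: "\<And>i. i \<ge> 1 \<Longrightarrow> distr M borel (V i) = P"
  shows "char (distr M borel (\<lambda>\<omega>. \<Sum>i=1..n+p. (if i \<le> n then a else b) * V i \<omega>)) t
    = char P (a * t) ^ n * char P (b * t) ^ p"
proof -
  have V: "V i \<in> borel_measurable M" if "i \<ge> 1" for i
    using indep that unfolding indep_vars_def2 by auto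
  have "indep_vars (\<lambda>_. borel) (\<lambda>i \<omega>. (if i \<le> n then a else b) * V i \<omega>) {1..n+p}"
    by (rule indep_vars_compose2[where X = V]) (auto intro: indep_vars_subset[OF indep])
  then have "char (distr M borel (\<lambda>\<omega>. \<Sum>i=1..n+p. (if i \<le> n then a else b) * V i \<omega>)) t
      = (\<Prod>i=1..n+p. char (distr M borel (\<lambda>\<omega>. (if i \<le> n then a else b) * V i \<omega>)) t)"
    by (rule char_distr_sum)
  also have "\<dots> = (\<Prod>i=1..n+p. char P ((if i \<le> n then a else b) * t))"
    using V ident by (intro prod.cong refl) (simp only: char_distr_mult atLeastAtMost_iff)
  finally show ?thesis by (simp only: prod_two_blocks)
qed

lemma cdf_distr_scale:
  assumes "Y \<in> borel_measurable M" "A \<in> borel_measurable M" "c > 0"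
    and "\<And>\<omega>. Y \<omega> = c * A \<omega>"
  shows "cdf (distr M borel Y) (c * x) = cdf (distr M borel A) x"
proof -
  have "Y -` {..c * x} \<inter> space M = A -` {..x} \<inter> space M" using assms by auto
  then show ?thesis using assms by (simp add: cdf_def measure_distr)
qed

lemma sample_mean_affine:
  assumes "N \<ge> 1"
  shows "sample_mean (\<lambda>i \<omega>. \<mu> + \<sigma> * V i \<omega>) N \<omega> = \<mu> + \<sigma> * ((\<Sum>i=1..N. V i \<omega>) / real N)"
  using assms by (simp add: sample_mean_def sum.distrib sum_distrib_left[symmetric] add_divide_distrib)

text \<open>In the increment a variable has weight
  \<open>1 / (n + k) - 1 / n = - k / (n * (n + k))\<close> if it is among the first
  \<open>n\<close>, and \<open>1 / (n + k)\<close> otherwise; the weights sum to 0, so \<mu>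
  cancels. Taking out \<open>sqrt k * \<sigma> / n\<close> leaves the stated coefficients.\<close>

lemma Delta_plus_eq:
  assumes "k \<ge> 1" "n \<ge> 1"
  shows "Delta_plus (\<lambda>i \<omega>. \<mu> + \<sigma> * V i \<omega>) n k \<omega> = sqrt k * \<sigma> / n *
    (\<Sum>i=1..n+k. (if i \<le> n then - sqrt k / (n + k) else n / (sqrt k * (n + k))) * V i \<omega>)"
proof -
  \<comment> \<open>\<open>r\<close> stands for \<open>sqrt k\<close>, which makes the identity
    rational.\<close>
  have alg: "\<sigma> * (T / (N + r\<^sup>2)) - \<sigma> * (S / N)
      = r * \<sigma> / N * (- r / (N + r\<^sup>2) * S + N / (r * (N + r\<^sup>2)) * (T - S))"
    if "r > 0" "N > 0" for r N S T :: real
  proof -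
    have "N + r\<^sup>2 \<noteq> 0" using that by (smt (verit) zero_le_power2)
    then show ?thesis using that by (simp add: divide_simps) (simp add: algebra_simps power2_eq_square)
  qed
  have r2: "(sqrt (real k))\<^sup>2 = real k" by simp
  show ?thesis
    using alg[of "sqrt k" "real n" "\<Sum>i=1..n+k. V i \<omega>" "\<Sum>i=1..n. V i \<omega>"] assms
    unfolding Delta_plus_def sum_two_blocks r2
    by (simp add: sample_mean_affine)
qed

text \<open>Here the blocks have lengths \<open>n - k\<close> and \<open>k\<close>, and the weights
  before rescaling are \<open>1 / n - 1 / (n - k)\<close> and \<open>1 / n\<close>.\<close>

lemma Delta_minus_eq:
  assumes "k \<ge> 1" "n > k"
  shows "Delta_minus (\<lambda>i \<omega>. \<mu> + \<sigma> * V i \<omega>) n k \<omega> = sqrt k * \<sigma> / n *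
    (\<Sum>i=1..(n-k)+k. (if i \<le> n - k then - sqrt k / (real n - real k) else 1 / sqrt k) * V i \<omega>)"
proof -
  have alg: "\<sigma> * (T / N) - \<sigma> * (S / (N - r\<^sup>2))
      = r * \<sigma> / N * (- r / (N - r\<^sup>2) * S + 1 / r * (T - S))"
    if "r > 0" "N > r\<^sup>2" for r N S T :: real
  proof -
    have "N \<noteq> 0" "N - r\<^sup>2 \<noteq> 0" using that by (smt (verit) zero_le_power2)+
    then show ?thesis using that by (simp add: divide_simps) (simp add: algebra_simps power2_eq_square)
  qed
  have r2: "(sqrt (real k))\<^sup>2 = real k" by simp
  have n: "n - k + k = n" "real (n - k) = real n - real k" "n - k \<ge> 1" using assms by auto
  show ?thesis
    using alg[of "sqrt k" "real n" "\<Sum>i=1..n. V i \<omega>" "\<Sum>i=1..n-k. V i \<omega>"] assms n(3)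
    unfolding Delta_minus_def sum_two_blocks r2
    by (simp add: sample_mean_affine n)
qed

section \<open>Asymptotics of the block length\<close>

text \<open>Eventually \<open>k n\<close> is at least half of \<open>n powr \<alpha>\<close>, so
  \<open>\<rho> ^ (k n - 1)\<close> decays at least like a stretched exponential and beats
  \<open>n\<^sup>2\<close>. The ratio is \<open>k n / n powr \<alpha>\<close> times
  \<open>n powr (\<alpha> - 1)\<close>.\<close>

lemma
  fixes k :: "nat \<Rightarrow> nat"
  assumes k_asymp: "(\<lambda>n. real (k n) / real n powr \<alpha>) \<longlonglongrightarrow> 1" and \<alpha>: "0 < \<alpha>" "\<alpha> < 1"
  shows block_length_at_top: "filterlim k at_top sequentially"
    and block_length_ratio: "(\<lambda>n. real (k n) / real n) \<longlonglongrightarrow> 0"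
    and block_length_exponential: "\<lbrakk>0 < \<rho>; \<rho> < 1\<rbrakk> \<Longrightarrow> (\<lambda>n. (real n)\<^sup>2 * \<rho> ^ (k n - 1)) \<longlonglongrightarrow> 0"
proof -
  have ev: "eventually (\<lambda>n. real n powr \<alpha> / 2 \<le> real (k n)) sequentially"
  proof -
    have "eventually (\<lambda>n. 1 / 2 < real (k n) / real n powr \<alpha>) sequentially"
      using order_tendstoD(1)[OF k_asymp, of "1 / 2"] by simp
    with eventually_gt_at_top[of "0::nat"] show ?thesis
      by eventually_elim (simp add: field_simps)
  qed
  have "filterlim (\<lambda>n. real n powr \<alpha> / 2) at_top sequentially"
    using \<alpha> by real_asymp
  then have "filterlim (\<lambda>n. real (k n)) at_top sequentially"
    by (rule filterlim_at_top_mono[OF _ ev])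
  then show "filterlim k at_top sequentially"
    by (simp add: filterlim_sequentially_iff_filterlim_real)
  have "(\<lambda>n. real (k n) / real n powr \<alpha> * real n powr (\<alpha> - 1)) \<longlonglongrightarrow> 1 * 0"
    using \<alpha> by (intro tendsto_mult k_asymp) real_asymp
  moreover have "eventually (\<lambda>n. real (k n) / real n powr \<alpha> * real n powr (\<alpha> - 1) = real (k n) / real n) sequentially"
    using eventually_gt_at_top[of "0::nat"]
    by eventually_elim (simp add: powr_diff)
  ultimately show "(\<lambda>n. real (k n) / real n) \<longlonglongrightarrow> 0"
    using Lim_transform_eventually by fastforce
  assume \<rho>: "0 < \<rho>" "\<rho> < 1"
  show "(\<lambda>n. (real n)\<^sup>2 * \<rho> ^ (k n - 1)) \<longlonglongrightarrow> 0"
  proof (rule Lim_null_comparison)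
    show "(\<lambda>n. (real n)\<^sup>2 * \<rho> powr (real n powr \<alpha> / 2 - 1)) \<longlonglongrightarrow> 0"
      using \<rho> \<alpha> by real_asymp
    show "eventually (\<lambda>n. norm ((real n)\<^sup>2 * \<rho> ^ (k n - 1)) \<le> (real n)\<^sup>2 * \<rho> powr (real n powr \<alpha> / 2 - 1)) sequentially"
      using ev
    proof eventually_elim
      case (elim n)
      have "\<rho> ^ (k n - 1) = \<rho> powr real (k n - 1)" using \<rho> by (simp add: powr_realpow)
      also have "\<dots> \<le> \<rho> powr (real n powr \<alpha> / 2 - 1)"
        using \<rho> elim by (intro powr_mono') auto
      finally show ?case using \<rho> by (simp add: mult_left_mono)
    qed
  qed
qed

section \<open>Uniform estimate for standardized variables, and its transfer to the original
  ones\<close>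

text \<open>The witness for \<open>B n\<close> is the sum of the two smoothing errors with
  \<open>\<delta> = 1 / n\<close> and the integral of \<open>G n\<close>. None of them depends on
  \<open>x\<close>, and each is small compared with \<open>k n / n\<close>.\<close>

lemma (in prob_space) sample_mean_difference_bound:
  fixes V :: "nat \<Rightarrow> 'a \<Rightarrow> real" and P :: "real measure" and k :: "nat \<Rightarrow> nat" and \<sigma> \<mu> :: real
  assumes indep: "indep_vars (\<lambda>_. borel) V {1..}"
    and ident: "\<And>i. i \<ge> 1 \<Longrightarrow> distr M borel (V i) = P"
    and 1: "integrable P (\<lambda>x. x)" "(\<integral>x. x \<partial>P) = 0"
    and 2: "integrable P (\<lambda>x. x\<^sup>2)" "(\<integral>x. x\<^sup>2 \<partial>P) = 1"
    and 3: "integrable P (\<lambda>x. \<bar>x\<bar> ^ 3)"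
    and cramer: "eventually (\<lambda>t. cmod (char P t) \<le> r) at_infinity" "r < 1"
    and \<sigma>: "\<sigma> > 0"
    and k_asymp: "(\<lambda>n. real (k n) / real n powr \<alpha>) \<longlonglongrightarrow> 1" and \<alpha>: "0 < \<alpha>" "\<alpha> < 1"
  defines "X \<equiv> (\<lambda>i \<omega>. \<mu> + \<sigma> * V i \<omega>)"
  obtains B where "(\<lambda>n. B n / (real (k n) / real n)) \<longlonglongrightarrow> 0"
    and "eventually (\<lambda>n. \<forall>x. \<bar>F_plus M X n (k n) (sqrt (real (k n)) * \<sigma> * x / real n)
                     - F_minus M X n (k n) (sqrt (real (k n)) * \<sigma> * x / real n)
                     - x * exp (- x\<^sup>2 / 2) / sqrt (2 * pi) * (real (k n) / real n)\<bar> \<le> B n) sequentially"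
proof -
  have V: "V i \<in> borel_measurable M" if "i \<ge> 1" for i
    using indep that unfolding indep_vars_def2 by auto
  interpret P: real_distribution P
    using real_distribution_distr[OF V[of 1]] ident[of 1] by simp
  obtain b \<rho> where b: "b > 0" and \<rho>: "0 < \<rho>" "\<rho> < 1"
    and decay: "\<And>a j. cmod (char P a) ^ j \<le> exp (- (b * real j * a\<^sup>2)) + \<rho> ^ j"
    using decay_of_doubling[of "\<lambda>t. cmod (char P t)" r] P.cmod_char_le_1 P.cmod_char_double cramer
    by auto
  \<comment> \<open>The hypotheses of the abstract estimates, with \<open>g\<close> the
    characteristic function of \<open>P\<close> and \<beta> its third absolute moment.\<close>
  note prems = P.char_zero P.cmod_char_le_1 P.char_diff_bound1[OF 1 2] P.char_diff_bound2[OF 1 2 3] decay b \<rho>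
    P.char_measurable block_length_at_top[OF k_asymp \<alpha>] block_length_ratio[OF k_asymp \<alpha>] block_length_exponential[OF k_asymp \<alpha> \<rho>]
  define Ap where "Ap n = (\<lambda>\<omega>. \<Sum>i=1..n + k n. (if i \<le> n then - sqrt (k n) / (real n + real (k n))
      else n / (sqrt (k n) * (real n + real (k n)))) * V i \<omega>)" for n
  define Am where "Am n = (\<lambda>\<omega>. \<Sum>i=1..(n - k n) + k n. (if i \<le> n - k n then - sqrt (k n) / (real n - real (k n))
      else 1 / sqrt (k n)) * V i \<omega>)" for n
  have A_meas: "Ap n \<in> borel_measurable M" "Am n \<in> borel_measurable M" for n
    unfolding Ap_def Am_def using V by (auto intro!: borel_measurable_sum borel_measurable_times)
  have int_V: "integrable M (V i)" if "i \<ge> 1" for i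
  proof -
    have "integrable (distr M borel (V i)) (\<lambda>x. x)" using 1(1) by (simp only: ident[OF that])
    from integrable_distr[OF V[OF that] this] show ?thesis .
  qed
  have int_A: "integrable (distr M borel (Ap n)) (\<lambda>x. x)" "integrable (distr M borel (Am n)) (\<lambda>x. x)" for n
  proof -
    have id: "(\<lambda>x::real. x) \<in> borel_measurable borel" by simp
    have distr_int: "integrable (distr M borel A) (\<lambda>x. x) = integrable M A"
      if "A \<in> borel_measurable M" for A :: "'a \<Rightarrow> real"
      by (rule integrable_distr_eq[OF that id])
    have "integrable M (Ap n)" "integrable M (Am n)"
      unfolding Ap_def Am_def using int_V
      by (auto intro!: Bochner_Integration.integrable_sum integrable_mult_right simp del: of_nat_add)
    then show "integrable (distr M borel (Ap n)) (\<lambda>x. x)" "integrable (distr M borel (Am n)) (\<lambda>x. x)"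
      by (simp_all only: distr_int A_meas)
  qed
  have char_A: "char (distr M borel (Ap n)) = cf_plus (char P) n (k n)"
    "char (distr M borel (Am n)) = cf_minus (char P) n (k n)" for n
    unfolding Ap_def Am_def cf_plus_def[abs_def] cf_minus_def[abs_def]
    by (simp_all only: fun_eq_iff char_two_blocks[OF indep ident]) simp_all
  define G where "G n t = cmod ((cf_plus (char P) n (k n) t - cf_minus (char P) n (k n) t) / of_real t
      * of_real (exp (- (1 / real n * t)\<^sup>2 / 2)) - of_real ((real (k n) / real n) * (t * exp (- t\<^sup>2 / 2))))" for n t
  note G = cf_diff_L1[OF prems, folded G_def]
  define Bp where "Bp n = 1 / real n * (\<integral>t. cmod (cf_plus (char P) n (k n) t) * exp (- (1 / real n * t)\<^sup>2 / 2) \<partial>lborel)" for n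
  define Bm where "Bm n = 1 / real n * (\<integral>t. cmod (cf_minus (char P) n (k n) t) * exp (- (1 / real n * t)\<^sup>2 / 2) \<partial>lborel)" for n
  have lim: "(\<lambda>n. (Bp n + Bm n + (\<integral>t. G n t \<partial>lborel)) / (real (k n) / real n)) \<longlonglongrightarrow> 0 + 0 + 0"
    unfolding add_divide_distrib
    by (intro tendsto_add G(2) cf_plus_mass_lim[OF prems, folded Bp_def] cf_minus_mass_lim[OF prems, folded Bm_def])
  show thesis
  proof (rule that)
    show "(\<lambda>n. (Bp n + Bm n + (\<integral>t. G n t \<partial>lborel)) / (real (k n) / real n)) \<longlonglongrightarrow> 0"
      using lim by simp
    show "eventually (\<lambda>n. \<forall>x. \<bar>F_plus M X n (k n) (sqrt (real (k n)) * \<sigma> * x / real n)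
                     - F_minus M X n (k n) (sqrt (real (k n)) * \<sigma> * x / real n)
                     - x * exp (- x\<^sup>2 / 2) / sqrt (2 * pi) * (real (k n) / real n)\<bar>
        \<le> Bp n + Bm n + (\<integral>t. G n t \<partial>lborel)) sequentially"
      using G(1) eventually_small_ratio[OF prems]
    proof eventually_elim
      case (elim n)
      let ?k = "k n"
      have k: "?k \<ge> 1" "n > ?k" "n \<ge> 1" and c: "sqrt ?k * \<sigma> / n > 0" using elim \<sigma> by auto
      have D: "Delta_plus X n ?k \<omega> = sqrt ?k * \<sigma> / n * Ap n \<omega>"
        "Delta_minus X n ?k \<omega> = sqrt ?k * \<sigma> / n * Am n \<omega>" for \<omega>
        unfolding X_def Ap_def Am_def
        by (simp_all only: Delta_plus_eq[OF k(1,3)] Delta_minus_eq[OF k(1,2)])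
      have D_meas: "Delta_plus X n ?k \<in> borel_measurable M" "Delta_minus X n ?k \<in> borel_measurable M"
        unfolding D[abs_def] using A_meas by auto
      show ?case
      proof
        fix x
        have scale: "sqrt (real ?k) * \<sigma> * x / real n = sqrt ?k * \<sigma> / n * x" by simp
        \<comment> \<open>The factor common to both increments is positive, so it can be divided out
          of the events that define the distribution functions.\<close>
        have F: "F_plus M X n ?k (sqrt (real ?k) * \<sigma> * x / real n) = cdf (distr M borel (Ap n)) x"
          "F_minus M X n ?k (sqrt (real ?k) * \<sigma> * x / real n) = cdf (distr M borel (Am n)) x"
          unfolding F_plus_def F_minus_def scale
          by (simp_all only: cdf_distr_scale[OF D_meas(1) A_meas(1) c D(1)] cdf_distr_scale[OF D_meas(2) A_meas(2) c D(2)])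
        have "\<bar>cdf (distr M borel (Ap n)) x - cdf (distr M borel (Am n)) x
            - x * exp (- x\<^sup>2 / 2) / sqrt (2 * pi) * (real ?k / real n)\<bar> \<le> Bp n + Bm n + (\<integral>t. G n t \<partial>lborel)"
          using cdf_diff_smoothing[OF real_distribution_distr[OF A_meas(1)] real_distribution_distr[OF A_meas(2)] int_A,
              of "1 / real n" n n "real ?k / real n" x] elim(1) k
          unfolding char_A G_def[abs_def] Bp_def Bm_def by simp
        then show "\<bar>F_plus M X n ?k (sqrt (real ?k) * \<sigma> * x / real n)
                     - F_minus M X n ?k (sqrt (real ?k) * \<sigma> * x / real n)
                     - x * exp (- x\<^sup>2 / 2) / sqrt (2 * pi) * (real ?k / real n)\<bar>
          \<le> Bp n + Bm n + (\<integral>t. G n t \<partial>lborel)"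
          unfolding F .
      qed
    qed
  qed
qed

theorem theorem3p1:
  fixes M :: "'a measure"
    and X :: "nat \<Rightarrow> 'a \<Rightarrow> real"
    and F :: "real \<Rightarrow> real"
    and f :: "real \<Rightarrow> complex"
    and \<sigma> \<alpha> :: real
    and m :: nat
    and k :: "nat \<Rightarrow> nat"
  assumes "prob_space M"
    and indep: "prob_space.indep_vars M (\<lambda>_. borel) X {1..}"
    and ident: "\<And>i. i \<ge> 1 \<Longrightarrow> cdf (distr M borel (X i)) = F"
    and charfun: "f = char (distr M borel (X 1))"
    and sigma: "\<sigma> \<ge> 0" "prob_space.variance M (X 1) = \<sigma>\<^sup>2"
    and cramer: "Limsup at_infinity (\<lambda>t. ereal (cmod (f t))) < 1"
    and m: "m \<ge> 1"
    and moment: "integrable M (\<lambda>\<omega>. \<bar>X 1 \<omega>\<bar> ^ (m + 2))"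
    and alpha: "\<alpha> \<in> {2 / (real m + 2) <..< 1}"
    and k_pos: "\<And>n. n \<ge> 1 \<Longrightarrow> k n \<ge> 1"
    and k_asymp: "(\<lambda>n. real (k n) / real n powr \<alpha>) \<longlonglongrightarrow> 1"
  shows "(\<lambda>n. SUP x. \<bar>F_plus M X n (k n) (sqrt (real (k n)) * \<sigma> * x / real n)
                     - F_minus M X n (k n) (sqrt (real (k n)) * \<sigma> * x / real n)
                     - x * exp (- x\<^sup>2 / 2) / sqrt (2 * pi) * (real (k n) / real n)\<bar>)
         \<in> o(\<lambda>n. real (k n) / real n)"
proof -
  interpret prob_space M by fact
  have X: "X i \<in> borel_measurable M" if "i \<ge> 1" for i
    using indep that unfolding indep_vars_def2 by auto
  have distr_eq: "distr M borel (X i) = distr M borel (X 1)" if "i \<ge> 1" for i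
    using real_distribution_distr[OF X] ident that by (intro cdf_unique) auto
  define \<mu> where "\<mu> = expectation (X 1)"
  define V where "V i \<omega> = (X i \<omega> - \<mu>) / \<sigma>" for i \<omega>
  define P where "P = distr M borel (V 1)"
  \<comment> \<open>Lower moments come from
    \<open>\<bar>y\<bar> ^ j \<le> 1 + \<bar>y\<bar> ^ (m + 2)\<close>; since
    \<open>m \<ge> 1\<close>, the third is among them.\<close>
  have power_mono_int: "integrable M (\<lambda>\<omega>. \<bar>X 1 \<omega>\<bar> ^ j)" if "j \<le> m + 2" for j
  proof (rule Bochner_Integration.integrable_bound)
    show "integrable M (\<lambda>\<omega>. 1 + \<bar>X 1 \<omega>\<bar> ^ (m + 2))" using moment by simp
    have "norm (\<bar>y\<bar> ^ j) \<le> norm (1 + \<bar>y\<bar> ^ (m + 2))" for y :: real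
    proof (cases "\<bar>y\<bar> \<le> 1")
      case True
      then have "\<bar>y\<bar> ^ j \<le> 1" by (simp add: power_le_one)
      then show ?thesis by (simp add: add_increasing2)
    next
      case False
      then have "\<bar>y\<bar> ^ j \<le> \<bar>y\<bar> ^ (m + 2)" using that by (intro power_increasing) auto
      then show ?thesis by simp
    qed
    then show "AE \<omega> in M. norm (\<bar>X 1 \<omega>\<bar> ^ j) \<le> norm (1 + \<bar>X 1 \<omega>\<bar> ^ (m + 2))" by simp
  qed (use X in simp)
  have X1: "X 1 \<in> borel_measurable M" by (rule X) simp
  have int_X: "integrable M (X 1)"
  proof (rule integrable_norm_cancel[OF _ X1])
    show "integrable M (\<lambda>\<omega>. norm (X 1 \<omega>))" using power_mono_int[of 1] by simp
  qed
  obtain r where r: "Limsup at_infinity (\<lambda>t. ereal (cmod (f t))) < ereal r" "r < 1"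
    using ereal_dense2[OF cramer] by auto
  obtain T where T: "\<And>t. T \<le> norm t \<Longrightarrow> cmod (f t) < r"
    using Limsup_lessD[OF r(1)] unfolding eventually_at_infinity by auto
  have int_dev: "integrable M (\<lambda>\<omega>. \<bar>X 1 \<omega> - \<mu>\<bar> ^ 3)"
  proof (rule Bochner_Integration.integrable_bound)
    show "integrable M (\<lambda>\<omega>. 8 * (\<bar>X 1 \<omega>\<bar> ^ 3 + \<bar>\<mu>\<bar> ^ 3))" using power_mono_int[of 3] m by simp
    have "norm (\<bar>y - \<mu>\<bar> ^ 3) \<le> norm (8 * (\<bar>y\<bar> ^ 3 + \<bar>\<mu>\<bar> ^ 3))" for y
    proof -
      have "\<bar>y - \<mu>\<bar> ^ 3 \<le> (2 * max \<bar>y\<bar> \<bar>\<mu>\<bar>) ^ 3" by (intro power_mono) auto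
      also have "\<dots> \<le> 8 * (\<bar>y\<bar> ^ 3 + \<bar>\<mu>\<bar> ^ 3)"
        by (simp add: power_mult_distrib max_def)
      finally show ?thesis by simp
    qed
    then show "AE \<omega> in M. norm (\<bar>X 1 \<omega> - \<mu>\<bar> ^ 3) \<le> norm (8 * (\<bar>X 1 \<omega>\<bar> ^ 3 + \<bar>\<mu>\<bar> ^ 3))" by simp
  qed (use X1 in simp)
  have int_sq: "integrable M (\<lambda>\<omega>. (X 1 \<omega> - \<mu>)\<^sup>2)"
    using power_mono_int[of 2] int_X by (simp add: power2_diff)
  \<comment> \<open>If \<sigma> were 0, \<open>X 1\<close> would be almost surely constant and
    \<open>f\<close> would have modulus 1 everywhere, against Cramer's condition.\<close>
  have \<sigma>_pos: "\<sigma> > 0"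
  proof (rule ccontr)
    assume "\<not> \<sigma> > 0"
    then have "expectation (\<lambda>\<omega>. (X 1 \<omega> - \<mu>)\<^sup>2) = 0" using sigma by (simp add: \<mu>_def)
    then have "AE \<omega> in M. (X 1 \<omega> - \<mu>)\<^sup>2 = 0"
      using integral_nonneg_eq_0_iff_AE[OF int_sq] by simp
    then have X_const: "AE \<omega> in M. X 1 \<omega> = \<mu>" by eventually_elim simp
    have "f t = iexp (t * \<mu>)" for t
    proof -
      have "f t = (CLINT \<omega>|M. iexp (t * X 1 \<omega>))"
        using X1 by (simp add: charfun char_def integral_distr)
      also have "\<dots> = (CLINT \<omega>|M. iexp (t * \<mu>))"
        using X_const X1 by (intro integral_cong_AE) auto
      finally show ?thesis using prob_space by (simp del: of_real_mult)
    qed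
    \<comment> \<open>\<open>T\<close> may be negative; \<open>\<bar>T\<bar>\<close> always lies in
      the range where \<open>cmod (f t) < r\<close>.\<close>
    then have "cmod (f \<bar>T\<bar>) = 1" by (simp del: of_real_mult)
    then show False using T[of "\<bar>T\<bar>"] abs_ge_self[of T] r(2) by simp
  qed
  have XV: "X = (\<lambda>i \<omega>. \<mu> + \<sigma> * V i \<omega>)" using \<sigma>_pos by (auto simp: V_def fun_eq_iff)
  have V1: "V 1 \<in> borel_measurable M" using X1 by (simp add: V_def[abs_def])
  have indep_V: "indep_vars (\<lambda>_. borel) V {1..}"
    unfolding V_def[abs_def] by (rule indep_vars_compose2[OF indep]) simp
  have ident_V: "distr M borel (V i) = P" if "i \<ge> 1" for i
  proof -
    have "distr M borel (V j) = distr (distr M borel (X j)) borel (\<lambda>x. (x - \<mu>) / \<sigma>)" if "j \<ge> 1" for j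
      using X[OF that] by (subst distr_distr) (auto simp: V_def[abs_def] comp_def)
    then show ?thesis using distr_eq[OF that] that by (simp add: P_def)
  qed
  have V_sq: "(V 1 \<omega>)\<^sup>2 = (X 1 \<omega> - \<mu>)\<^sup>2 / \<sigma>\<^sup>2" and V_cube: "\<bar>V 1 \<omega>\<bar> ^ 3 = \<bar>X 1 \<omega> - \<mu>\<bar> ^ 3 / \<sigma> ^ 3" for \<omega>
    using \<sigma>_pos by (simp_all add: V_def power_divide)
  have P: "integrable P (\<lambda>x. x)" "(\<integral>x. x \<partial>P) = 0" "integrable P (\<lambda>x. x\<^sup>2)" "(\<integral>x. x\<^sup>2 \<partial>P) = 1"
    "integrable P (\<lambda>x. \<bar>x\<bar> ^ 3)"
  proof -
    show "integrable P (\<lambda>x. x)" "(\<integral>x. x \<partial>P) = 0"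
      unfolding P_def using V1 int_X prob_space
      by (simp_all add: integrable_distr_eq integral_distr V_def \<mu>_def)
    show "integrable P (\<lambda>x. x\<^sup>2)" "integrable P (\<lambda>x. \<bar>x\<bar> ^ 3)"
      unfolding P_def using V1 int_sq int_dev by (simp_all add: integrable_distr_eq V_sq V_cube del: One_nat_def)
    show "(\<integral>x. x\<^sup>2 \<partial>P) = 1"
      unfolding P_def using V1 sigma \<sigma>_pos by (simp add: integral_distr V_sq \<mu>_def del: One_nat_def)
  qed
  \<comment> \<open>Standardizing changes the characteristic function by a phase and a rescaling of
    \<open>t\<close>, so the same \<open>r\<close> works with the threshold
    \<open>T * \<sigma>\<close>.\<close>
  have cramer_V: "eventually (\<lambda>t. cmod (char P t) \<le> r) at_infinity"
  proof -
    have char_P: "cmod (char P t) = cmod (f (t / \<sigma>))" for t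
    proof -
      have pt: "iexp (t * V 1 \<omega>) = iexp (- (t * \<mu> / \<sigma>)) * iexp (t / \<sigma> * X 1 \<omega>)" for \<omega>
        using \<sigma>_pos by (simp add: V_def exp_add[symmetric] field_simps)
      have "char P t = (CLINT \<omega>|M. iexp (t * V 1 \<omega>))"
        using V1 by (simp add: P_def char_def integral_distr)
      also have "\<dots> = iexp (- (t * \<mu> / \<sigma>)) * (CLINT \<omega>|M. iexp (t / \<sigma> * X 1 \<omega>))"
        unfolding pt by (rule integral_mult_right_zero)
      also have "(CLINT \<omega>|M. iexp (t / \<sigma> * X 1 \<omega>)) = f (t / \<sigma>)"
        using X1 by (simp add: charfun char_def integral_distr)
      finally show ?thesis by (simp only: norm_mult norm_exp_i_times mult_1_left)
    qed
    have "cmod (char P t) \<le> r" if "T * \<sigma> \<le> norm t" for t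
      using T[of "t / \<sigma>"] that \<sigma>_pos by (simp add: char_P field_simps)
    then show ?thesis unfolding eventually_at_infinity by auto
  qed
  have \<alpha>: "0 < \<alpha>" "\<alpha> < 1"
    using alpha by (auto intro: less_trans[of 0 "2 / (real m + 2)"])
  let ?R = "\<lambda>n x. \<bar>F_plus M X n (k n) (sqrt (real (k n)) * \<sigma> * x / real n)
                     - F_minus M X n (k n) (sqrt (real (k n)) * \<sigma> * x / real n)
                     - x * exp (- x\<^sup>2 / 2) / sqrt (2 * pi) * (real (k n) / real n)\<bar>"
  obtain B where B: "(\<lambda>n. B n / (real (k n) / real n)) \<longlonglongrightarrow> 0"
    and R: "eventually (\<lambda>n. \<forall>x. ?R n x \<le> B n) sequentially"
    using sample_mean_difference_bound[OF indep_V ident_V P cramer_V r(2) \<sigma>_pos k_asymp \<alpha>, of \<mu>, folded XV]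
    by blast
  show ?thesis
  proof (rule smalloI_tendsto)
    show "(\<lambda>n. (SUP x. ?R n x) / (real (k n) / real n)) \<longlonglongrightarrow> 0"
    proof (rule Lim_null_comparison[OF _ B])
      show "eventually (\<lambda>n. norm ((SUP x. ?R n x) / (real (k n) / real n)) \<le> B n / (real (k n) / real n)) sequentially"
        using R
      proof eventually_elim
        case (elim n)
        have "(SUP x. ?R n x) \<le> B n" using elim by (intro cSUP_least) auto
        \<comment> \<open>The value at \<open>x = 0\<close> is an absolute value; that the supremum
          dominates it rests on the remainder being bounded above.\<close>
        moreover have "0 \<le> (SUP x. ?R n x)"
          by (rule cSUP_upper2[where x = 0]) (use bdd_above_remainder[OF \<open>prob_space M\<close> X] in auto)
        moreover have "norm (S / e) \<le> S' / e" if "S \<le> S'" "0 \<le> S" "0 \<le> e" for S S' e :: real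
          using that by (simp add: divide_right_mono)
        ultimately show ?case by (simp only: divide_nonneg_nonneg of_nat_0_le_iff)
      qed
    qed
    show "eventually (\<lambda>n. real (k n) / real n \<noteq> 0) sequentially"
      using eventually_gt_at_top[of "0::nat"]
    proof eventually_elim
      case (elim n)
      then show ?case using k_pos[of n] by simp
    qed
  qed
qed

end
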